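(* Let $0<d<\pi/2$, $\mathscr{D}_d=\{\zeta\in\mathbb{C}:|\Im\zeta|<d\}$, and let $i\in\{2,3\}$, with $\psi_2(t)=e^t$, $\psi_3(t)=\operatorname{arcsinh}(e^t)$, $E_2(z;\alpha,\beta)=z^{\alpha-1}(1+z^2)^{-(\alpha+\beta)/2}$, $E_3(z;\alpha,\beta)=\left(\frac{z}{1+z}\right)^{\alpha-1}e^{-\beta z}$. Assume $f$ is analytic on $\psi_i(\mathscr{D}_d)$ and there are constants $K,\alpha,\beta>0$ with $|f(z)|\le K|E_i(z;\alpha,\beta)|$ for all $z\in\psi_i(\mathscr{D}_d)$. Let $\mu=\min\{\alpha,\beta\}$, let $n$ be a positive integer, $h=\sqrt{2\pi d/(\mu n)}$, and let $M=n$, $N=\lceil\alpha n/\beta\rceil$ if $\mu=\alpha$, and $N=n$, $M=\lceil\beta n/\alpha\rceil$ if $\mu=\beta$. Then \[ \left|\int_{0}^{\infty} f(t)\,dt-h\sum_{k=-M}^{N} f(\psi_i(kh))\psi_i'(kh)\right|\le C_i\,e^{-\sqrt{2\pi d\mu n}}, \] where \[ C_2=\frac{2K}{\mu}\left\{\frac{2}{(1-e^{-\sqrt{2\pi d\mu}})(\cos d)^{(\alpha+\beta)/2}}+1\right\},\quad C_3=\frac{2K}{\mu}\left\{\frac{2^{1+\beta/2}c_{\alpha,d}}{(1-e^{-\sqrt{2\pi d\mu}})(\cos d)^{(\alpha+\beta)/2}}+2^{(1-\alpha+|1-\alpha|)/2}\right\}, \] and $c_{\alpha,d}=\{2(1+1/\cos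 d)\}^{(1-\alpha)/2}$ if $0<\alpha<1$, $c_{\alpha,d}=2^{(\alpha-1)/2}$ if $\alpha\ge 1$.
   Context: $\psi_i(\mathscr{D}_d)$ is the image of the strip under $\psi_i$. Complex powers use principal branches. *)

theory Defs
  imports "HOL-Analysis.Analysis"
begin

definition strip :: "real \<Rightarrow> complex set" where
  "strip d = {z. \<bar>Im z\<bar> < d}"

definition psi :: "nat \<Rightarrow> complex \<Rightarrow> complex" where
  "psi i z = (if i = 2 then exp z else arsinh (exp z))"

definition E :: "nat \<Rightarrow> complex \<Rightarrow> real \<Rightarrow> real \<Rightarrow> complex" where
  "E i z \<alpha> \<beta> =
     (if i = 2 then z powr (of_real (\<alpha> - 1)) * (1 + z\<^sup>2) powr (of_real (- (\<alpha> + \<beta>) / 2))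
      else (z / (1 + z)) powr (of_real (\<alpha> - 1)) * exp (- of_real \<beta> * z))"

definition c_ad :: "real \<Rightarrow> real \<Rightarrow> real" where
  "c_ad \<alpha> d = (if \<alpha> < 1 then (2 * (1 + 1 / cos d)) powr ((1 - \<alpha>) / 2) else 2 powr ((\<alpha> - 1) / 2))"

definition C_const :: "nat \<Rightarrow> real \<Rightarrow> real \<Rightarrow> real \<Rightarrow> real \<Rightarrow> real" where
  "C_const i K \<alpha> \<beta> d =
     (let \<mu> = min \<alpha> \<beta> in
      if i = 2 then
        2 * K / \<mu> * (2 / ((1 - exp (- sqrt (2 * pi * d * \<mu>))) * cos d powr ((\<alpha> + \<beta>) / 2)) + 1)
      else
        2 * K / \<mu> * (2 powr (1 + \<beta> / 2) * c_ad \<alpha> d /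
             ((1 - exp (- sqrt (2 * pi * d * \<mu>))) * cos d powr ((\<alpha> + \<beta>) / 2))
           + 2 powr ((1 - \<alpha> + \<bar>1 - \<alpha>\<bar>) / 2)))"

end

theory Submission
  imports Defs "HOL-Complex_Analysis.Residue_Theorem" "HOL-Real_Asymp.Real_Asymp"
begin

text \<open>
  Substituting \<open>t = \<psi>(x)\<close> turns the integral into that of \<open>F = (f \<circ> \<psi>) \<psi>'\<close> over the real line.
  On the strip \<open>F\<close> is bounded by a multiple of \<open>min (e\<^sup>\<alpha>\<^sup>x) (e\<^sup>-\<^sup>\<beta>\<^sup>x)\<close>, \<open>x = Re \<zeta>\<close>.
  The kernel \<open>\<kappa>(z) = 1 / (exp (- 2\<pi>iz/h) - 1)\<close> has simple poles at the nodes \<open>kh\<close>, satisfies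
  \<open>\<kappa>(z) + \<kappa>(-z) = -1\<close>, and is of size \<open>exp (- 2\<pi>d/h)\<close> on the upper edge of the strip. The residue
  theorem for \<open>F \<kappa>\<close> on rectangles whose vertical sides lie midway between two nodes therefore bounds
  the discretization error by \<open>2 / (exp (2\<pi>d/h) - 1)\<close> times the integral of the majorant; the
  truncation error is a sum of two geometric tails. The choice of \<open>h\<close>, \<open>M\<close>, \<open>N\<close> balances the two.

  For \<open>\<psi>\<^sub>3\<close> put \<open>z = arsinh w\<close> with \<open>w = e\<^sup>\<zeta>\<close>, so \<open>\<psi>\<^sub>3' = tanh z\<close>. The factor \<open>z/(1 + z)\<close> is
  comparable to \<open>tanh z\<close> up to the constant in \<open>c_ad\<close>, after which \<open>|cosh z|\<^sup>2 = |1 + w\<^sup>2|\<close> and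
  \<open>|cosh z| \<le> exp (Re z)\<close> reduce the majorant for \<open>E 3\<close> at \<open>z\<close> to the one for \<open>E 2\<close> at \<open>w\<close>, where
  \<open>(1 + |w|\<^sup>2) cos d \<le> |1 + w\<^sup>2|\<close>.
\<close>

subsection \<open>Contour integrals over rectangles\<close>

abbreviation horizontal_line :: "real \<Rightarrow> real \<Rightarrow> real \<Rightarrow> real \<Rightarrow> complex" where
  "horizontal_line a b y \<equiv> linepath (Complex a y) (Complex b y)"

abbreviation vertical_line :: "real \<Rightarrow> real \<Rightarrow> real \<Rightarrow> real \<Rightarrow> complex" where
  "vertical_line x a b \<equiv> linepath (Complex x a) (Complex x b)"

lemma contour_integral_rectpath:
  assumes "continuous_on (path_image (rectpath (Complex a c) (Complex b d))) f"
  shows "contour_integral (rectpath (Complex a c) (Complex b d)) f =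
      contour_integral (horizontal_line a b c) f
    + contour_integral (vertical_line b c d) f
    - contour_integral (horizontal_line a b d) f
    - contour_integral (vertical_line a c d) f"
proof -
  let ?a = "Complex a c" and ?b = "Complex b c" and ?c = "Complex b d" and ?d = "Complex a d"
  have image: "path_image (rectpath ?a ?c) =
      closed_segment ?a ?b \<union> closed_segment ?b ?c \<union> closed_segment ?c ?d \<union> closed_segment ?d ?a"
    by (simp add: rectpath_def Let_def path_image_join Un_assoc)
  have cont: "continuous_on (closed_segment ?a ?b) f" "continuous_on (closed_segment ?b ?c) f"
      "continuous_on (closed_segment ?c ?d) f" "continuous_on (closed_segment ?d ?a) f"
    using assms by (auto elim: continuous_on_subset simp: image)
  have "contour_integral (rectpath ?a ?c) f =
      contour_integral (linepath ?a ?b) f + contour_integral (linepath ?b ?c) f +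
      contour_integral (linepath ?c ?d) f + contour_integral (linepath ?d ?a) f"
    using cont[THEN contour_integrable_continuous_linepath]
    by (simp add: rectpath_def Let_def add.assoc)
  thus ?thesis
    using cont(3,4)[THEN contour_integral_reverse_linepath] by simp
qed

lemma contour_integral_horizontal_line:
  assumes "a < b"
  shows "contour_integral (horizontal_line a b y) f =
    integral {a..b} (\<lambda>x. f (Complex x y))"
proof -
  have "contour_integral (horizontal_line a b y) f =
      contour_integral (linepath (of_real a) (of_real b)) (\<lambda>z. f (z + \<i> * y))"
    by (simp add: contour_integral_integral linepath_def Complex_eq scaleR_conv_of_real algebra_simps)
  also have "\<dots> = integral {a..b} (\<lambda>x. f (Complex x y))"
    using assms by (simp add: contour_integral_linepath_Reals_eq Complex_eq)
  finally show ?thesis .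
qed

lemma norm_contour_integral_horizontal_line_le:
  assumes "a < b" and cont: "continuous_on (closed_segment (Complex a y) (Complex b y)) f"
    and "G integrable_on {a..b}" "\<And>x. x \<in> {a..b} \<Longrightarrow> norm (f (Complex x y)) \<le> G x"
  shows "norm (contour_integral (horizontal_line a b y) f) \<le> integral {a..b} G"
  unfolding contour_integral_horizontal_line[OF \<open>a < b\<close>]
proof (rule integral_norm_bound_integral)
  show "(\<lambda>x. f (Complex x y)) integrable_on {a..b}"
    using assms(1) by (intro integrable_continuous_real continuous_on_compose2[OF cont])
      (auto simp: Complex_eq closed_segment_same_Im closed_segment_eq_real_ivl intro!: continuous_intros)
qed (use assms in auto)

lemma norm_contour_integral_vertical_line_le:
  assumes "a \<le> b" "continuous_on (closed_segment (Complex x a) (Complex x b)) f"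
    and "\<And>y. y \<in> {a..b} \<Longrightarrow> norm (f (Complex x y)) \<le> B"
  shows "norm (contour_integral (vertical_line x a b) f) \<le> B * (b - a)"
proof -
  have "0 \<le> B" using assms(1) by (intro order_trans[OF norm_ge_zero assms(3)[of a]]) simp
  moreover have "norm (f z) \<le> B" if "z \<in> closed_segment (Complex x a) (Complex x b)" for z
    using that assms(1) assms(3)[of "Im z"] complex_surj[of z]
    by (auto simp: closed_segment_same_Re closed_segment_eq_real_ivl)
  ultimately have "norm (contour_integral (vertical_line x a b) f)
      \<le> B * norm (Complex x b - Complex x a)"
    using assms(2) by (intro contour_integral_bound_linepath contour_integrable_continuous_linepath)
  also have "norm (Complex x b - Complex x a) = b - a"
    using assms(1) by (simp add: cmod_def)
  finally show ?thesis .
qed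

subsection \<open>The trapezoidal rule on a strip\<close>

lemma open_strip: "open (strip d)" and convex_strip: "convex (strip d)"
proof -
  have strip_eq: "strip d = {z. Im z < d} \<inter> {z. Im z > - d}" by (auto simp: strip_def)
  show "open (strip d)" unfolding strip_eq
    by (intro open_Int open_halfspace_Im_lt open_halfspace_Im_gt)
  show "convex (strip d)" unfolding strip_eq
    by (intro convex_Int convex_halfspace_Im_lt convex_halfspace_Im_gt)
qed

definition grid :: "real \<Rightarrow> complex set" where
  "grid h = range (\<lambda>k::int. of_real (of_int k * h))"

definition trapezoidal_sum :: "real \<Rightarrow> int \<Rightarrow> int \<Rightarrow> (complex \<Rightarrow> complex) \<Rightarrow> complex" where
  "trapezoidal_sum h M N F = of_real h * (\<Sum>k=M..N. F (of_real (of_int k * h)))"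

definition trapezoidal_kernel :: "real \<Rightarrow> complex \<Rightarrow> complex" where
  "trapezoidal_kernel h z = 1 / (exp (- (2 * pi * \<i> * z / h)) - 1)"

lemma uminus_in_grid_iff [simp]: "- z \<in> grid h \<longleftrightarrow> z \<in> grid h"
proof -
  have "- z \<in> grid h" if "z \<in> grid h" for z
    using that by (auto simp: grid_def image_iff intro: exI[of _ "- _"])
  from this[of z] this[of "- z"] show ?thesis by auto
qed

lemma exp_eq_1_iff_in_grid:
  assumes "0 < h"
  shows "exp (- (2 * pi * \<i> * z / h)) = 1 \<longleftrightarrow> z \<in> grid h"
proof -
  have "exp (- (2 * pi * \<i> * z / h)) = 1 \<longleftrightarrow> exp (2 * pi * \<i> * z / h) = 1"
    by (simp add: exp_minus)
  also have "\<dots> \<longleftrightarrow> Im z = 0 \<and> (\<exists>k::int. Re z = of_int k * h)"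
    using assms by (auto simp: exp_eq_1 field_simps Re_divide Im_divide power2_eq_square)
  finally show ?thesis by (auto simp: grid_def complex_eq_iff)
qed

lemma holomorphic_on_trapezoidal_kernel:
  assumes "0 < h" "A \<inter> grid h = {}"
  shows "trapezoidal_kernel h holomorphic_on A"
  unfolding trapezoidal_kernel_def
  using assms exp_eq_1_iff_in_grid[OF assms(1)] by (intro holomorphic_intros) auto

lemma holomorphic_on_trapezoidal_kernel_uminus:
  assumes "0 < h" "A \<inter> grid h = {}"
  shows "(\<lambda>z. trapezoidal_kernel h (- z)) holomorphic_on A"
proof -
  have "trapezoidal_kernel h holomorphic_on uminus ` A"
    using assms by (intro holomorphic_on_trapezoidal_kernel) auto
  thus ?thesis
    using holomorphic_on_compose[of uminus A "trapezoidal_kernel h"]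
    by (simp add: o_def holomorphic_intros)
qed

lemma trapezoidal_kernel_uminus:
  assumes "0 < h" "z \<notin> grid h"
  shows "trapezoidal_kernel h (- z) = - 1 - trapezoidal_kernel h z"
proof -
  have "1 / (inverse e - 1) = - 1 - 1 / (e - 1)" if "e \<noteq> 0" "e \<noteq> 1" for e :: complex
    using that by (simp add: divide_simps) (simp add: algebra_simps)
  from this[of "exp (- (2 * pi * \<i> * z / h))"] show ?thesis
    using assms exp_eq_1_iff_in_grid[OF assms(1), of z]
    by (simp add: trapezoidal_kernel_def exp_minus)
qed

lemma norm_trapezoidal_kernel_le:
  assumes "0 < h" "0 < Im z"
  shows "norm (trapezoidal_kernel h z) \<le> 1 / (exp (2 * pi * Im z / h) - 1)"
proof -
  let ?e = "exp (- (2 * pi * \<i> * z / h))"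
  have "exp (2 * pi * Im z / h) - 1 = norm ?e - norm (1 :: complex)"
    using assms by (simp add: Re_divide Im_divide power2_eq_square)
  also have "\<dots> \<le> norm (?e - 1)" by (rule norm_triangle_ineq2)
  finally show ?thesis
    using assms unfolding trapezoidal_kernel_def norm_divide
    by (intro frac_le) auto
qed

lemma norm_trapezoidal_kernel_half_integer_le:
  assumes "0 < h"
  shows "norm (trapezoidal_kernel h (Complex ((of_int k + 1 / 2) * h) y)) \<le> 1"
proof -
  let ?r = "exp (2 * pi * y / h)"
  have "exp (- (2 * pi * \<i> * Complex ((of_int k + 1 / 2) * h) y / h)) =
      exp (of_real (2 * pi * y / h) + (\<i> * of_real (2 * pi * of_int (- k)) + - (\<i> * of_real pi)))"
    using assms by (intro arg_cong[where f = exp])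
      (simp add: complex_eq_iff Re_divide Im_divide power2_eq_square field_simps)
  also have "\<dots> = - of_real ?r"
    by (simp only: exp_add exp_of_real exp_minus cis_conv_exp[symmetric]
          cis_multiple_2pi[OF Ints_of_int] cis_pi) simp
  finally have "trapezoidal_kernel h (Complex ((of_int k + 1 / 2) * h) y) = of_real (1 / (- ?r - 1))"
    by (simp add: trapezoidal_kernel_def)
  moreover have "\<bar>1 / (- r - 1)\<bar> \<le> 1" if "0 < r" for r :: real
    using that by (simp add: abs_if divide_simps)
  ultimately show ?thesis by (simp only: norm_of_real exp_gt_zero)
qed

lemma half_integer_notin_grid:
  assumes "0 < h"
  shows "Complex ((of_int k + 1 / 2) * h) y \<notin> grid h"
proof
  assume "Complex ((of_int k + 1 / 2) * h) y \<in> grid h"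
  then obtain j :: int where "Complex ((of_int k + 1 / 2) * h) y = of_real (of_int j * h)"
    unfolding grid_def by blast
  hence "(of_int k + 1 / 2) * h = of_int j * h"
    by (metis Re_complex_of_real complex.sel(1))
  hence "2 * k + 1 = 2 * j" using assms by simp
  thus False by presburger
qed

lemma residue_mult_trapezoidal_kernel:
  assumes "open S" "p \<in> S" "p \<in> grid h" "0 < h" and F: "F holomorphic_on S"
  shows "residue (\<lambda>z. F z * trapezoidal_kernel h z) p = - (h / (2 * pi * \<i>)) * F p"
proof (rule residue_simple')
  show "open (S \<inter> ball p h)" "p \<in> S \<inter> ball p h" using assms by auto
  have "(S \<inter> ball p h - {p}) \<inter> grid h = {}"
  proof -
    have "q = p" if q: "q \<in> grid h" "dist p q < h" for q
    proof -
      obtain j k :: int where jk: "p = of_real (of_int j * h)" "q = of_real (of_int k * h)"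
        using q(1) assms(3) unfolding grid_def by blast
      have "dist p q = \<bar>of_int (j - k) * h\<bar>"
        unfolding jk dist_norm of_real_diff[symmetric] norm_of_real by (simp add: left_diff_distrib)
      hence "\<bar>of_int (j - k) :: real\<bar> < 1" using q(2) assms(4) by (simp add: abs_mult)
      hence "k = j" by linarith
      thus "q = p" by (simp add: jk)
    qed
    thus ?thesis by auto
  qed
  thus "(\<lambda>z. F z * trapezoidal_kernel h z) holomorphic_on S \<inter> ball p h - {p}"
    using assms
    by (intro holomorphic_on_mult holomorphic_on_trapezoidal_kernel holomorphic_on_subset[OF F]) auto
  let ?e = "\<lambda>z. exp (- (2 * pi * \<i> * z / h))"
  have e: "?e p = 1" using assms exp_eq_1_iff_in_grid by blast
  have "(?e has_field_derivative ?e p * - (2 * pi * \<i> / h)) (at p)"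
    using assms by (auto intro!: derivative_eq_intros)
  hence "(\<lambda>z. (?e z - 1) / (z - p)) \<midarrow>p\<rightarrow> - (2 * pi * \<i> / h)"
    unfolding has_field_derivative_iff by (simp only: e mult_1)
  moreover have "F \<midarrow>p\<rightarrow> F p"
    using assms
    by (metis continuous_on_eq_continuous_at holomorphic_on_imp_continuous_on isCont_def)
  ultimately have "(\<lambda>z. F z / ((?e z - 1) / (z - p))) \<midarrow>p\<rightarrow> F p / - (2 * pi * \<i> / h)"
    using assms by (intro tendsto_divide) auto
  thus "(\<lambda>z. F z * trapezoidal_kernel h z * (z - p)) \<midarrow>p\<rightarrow> - (h / (2 * pi * \<i>)) * F p"
    using assms by (simp add: trapezoidal_kernel_def mult.commute)
qed

lemma grid_Int_box:
  fixes m :: nat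
  assumes "0 < h" "0 < d"
  defines "X \<equiv> (of_nat m + 1) * h"
  shows "grid h \<inter> box (Complex (-X) (-d)) (Complex X d) =
    (\<lambda>k. of_real (of_int k * h)) ` {-int m..int m}"
proof -
  have "of_real (of_int k * h) \<in> box (Complex (-X) (-d)) (Complex X d) \<longleftrightarrow> k \<in> {-int m..int m}" for k :: int
  proof -
    have "of_real (of_int k * h) \<in> box (Complex (-X) (-d)) (Complex X d) \<longleftrightarrow> \<bar>of_int k * h\<bar> < X"
      using assms(2) by (simp add: in_box_complex_iff abs_less_iff conj_commute minus_less_iff)
    also have "\<dots> \<longleftrightarrow> \<bar>of_int k\<bar> < (of_nat m + 1 :: real)"
      using assms(1) by (simp add: X_def abs_mult)
    also have "\<dots> \<longleftrightarrow> k \<in> {-int m..int m}" by auto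
    finally show ?thesis .
  qed
  hence "{k. of_real (of_int k * h) \<in> box (Complex (-X) (-d)) (Complex X d)} = {-int m..int m}"
    by (simp only: Collect_mem_eq)
  thus ?thesis unfolding grid_def by blast
qed

lemma grid_nodes_subset_box:
  fixes m :: nat
  assumes "0 < h" "0 < \<delta>"
  defines "X \<equiv> (of_nat m + 1 / 2) * h"
  shows "(\<lambda>k. of_real (of_int k * h)) ` {-int m..int m} \<subseteq> box (Complex (-X) (-\<delta>)) (Complex X \<delta>)"
proof (rule image_subsetI)
  fix k assume "k \<in> {-int m..int m}"
  hence "\<bar>of_int k\<bar> * h < X" using assms(1) by (auto simp: X_def)
  hence "\<bar>of_int k * h\<bar> < X" using assms(1) by (simp add: abs_mult)
  thus "of_real (of_int k * h) \<in> box (Complex (-X) (-\<delta>)) (Complex X \<delta>)"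
    using assms(2) by (auto simp: in_box_complex_iff)
qed

lemma rectpath_trapezoidal_kernel:
  fixes F :: "complex \<Rightarrow> complex" and m :: nat
  assumes F: "F holomorphic_on strip d" and \<delta>: "0 < \<delta>" "\<delta> < d" and h: "0 < h"
    and X: "X = (of_nat m + 1 / 2) * h"
  shows "continuous_on (path_image (rectpath (Complex (-X) (-\<delta>)) (Complex X \<delta>)))
           (\<lambda>z. F z * trapezoidal_kernel h z)"
    and "contour_integral (rectpath (Complex (-X) (-\<delta>)) (Complex X \<delta>))
           (\<lambda>z. F z * trapezoidal_kernel h z) = - trapezoidal_sum h (-int m) (int m) F"
proof -
  define S where "S = box (Complex (- ((of_nat m + 1) * h)) (-d)) (Complex ((of_nat m + 1) * h) d)"
  define P where "P = (\<lambda>k. complex_of_real (of_int k * h)) ` {-int m..int m}"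
  let ?box = "box (Complex (-X) (-\<delta>)) (Complex X \<delta>)"
  let ?\<gamma> = "rectpath (Complex (-X) (-\<delta>)) (Complex X \<delta>)" and ?f = "\<lambda>z. F z * trapezoidal_kernel h z"
  have X_bounds: "0 < X" "X < (of_nat m + 1) * h"
    using h by (auto simp: X algebra_simps intro: add_nonneg_pos)
  have S: "open S" "connected S"
    by (simp_all add: S_def open_box convex_connected[OF convex_box(2)])
  have P: "P = grid h \<inter> S" unfolding P_def S_def using h \<delta> by (intro grid_Int_box[symmetric]) auto
  have P_box: "P \<subseteq> ?box" unfolding P_def X by (rule grid_nodes_subset_box[OF h \<delta>(1)])
  have cbox_S: "cbox (Complex (-X) (-\<delta>)) (Complex X \<delta>) \<subseteq> S"
    using \<delta> X_bounds by (auto simp: S_def in_cbox_complex_iff in_box_complex_iff)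
  have F_S: "F holomorphic_on S"
    using F by (rule holomorphic_on_subset) (auto simp: S_def strip_def in_box_complex_iff)
  have f: "?f holomorphic_on S - P"
    using h
    by (intro holomorphic_on_mult holomorphic_on_trapezoidal_kernel holomorphic_on_subset[OF F_S])
      (auto simp: P)
  have image: "path_image ?\<gamma> \<subseteq> S - P"
    using path_image_rectpath_cbox_minus_box[of "Complex (-X) (-\<delta>)" "Complex X \<delta>"] cbox_S P_box X_bounds \<delta>
    by auto
  show "continuous_on (path_image ?\<gamma>) ?f"
    using f image holomorphic_on_imp_continuous_on continuous_on_subset by blast
  have "contour_integral ?\<gamma> ?f = 2 * pi * \<i> * (\<Sum>p\<in>P. winding_number ?\<gamma> p * residue ?f p)"
    using S f image cbox_S X_bounds \<delta>
    by (intro Residue_theorem[where S = S]) (auto simp: P_def intro!: winding_number_rectpath_outside)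
  also have "(\<Sum>p\<in>P. winding_number ?\<gamma> p * residue ?f p) = (\<Sum>p\<in>P. - (h / (2 * pi * \<i>)) * F p)"
  proof (rule sum.cong)
    fix p assume "p \<in> P"
    hence "p \<in> ?box" "p \<in> S" "p \<in> grid h" using P_box cbox_S box_subset_cbox P by blast+
    thus "winding_number ?\<gamma> p * residue ?f p = - (h / (2 * pi * \<i>)) * F p"
      using residue_mult_trapezoidal_kernel[OF S(1) _ _ h F_S]
      by (simp add: winding_number_rectpath)
  qed simp
  also have "\<dots> = - (h / (2 * pi * \<i>)) * (\<Sum>k=-int m..int m. F (of_real (of_int k * h)))"
    unfolding P_def using h
    by (simp only: sum_distrib_left) (subst sum.reindex, auto simp: inj_on_def o_def)
  finally show "contour_integral ?\<gamma> ?f = - trapezoidal_sum h (-int m) (int m) F"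
    by (simp add: trapezoidal_sum_def)
qed

lemma contour_integral_mult_trapezoidal_kernel:
  assumes h: "0 < h" and F: "continuous_on (closed_segment a b) F"
    and grid: "closed_segment a b \<inter> grid h = {}"
  shows "contour_integral (linepath a b) (\<lambda>z. F z * trapezoidal_kernel h z) =
    - contour_integral (linepath a b) F
    - contour_integral (linepath a b) (\<lambda>z. F z * trapezoidal_kernel h (- z))"
proof -
  have "contour_integral (linepath a b) (\<lambda>z. F z * trapezoidal_kernel h z) =
      contour_integral (linepath a b) (\<lambda>z. - F z - F z * trapezoidal_kernel h (- z))"
  proof (rule contour_integral_eq)
    fix z assume "z \<in> path_image (linepath a b)"
    hence "trapezoidal_kernel h z = - 1 - trapezoidal_kernel h (- z)"
      using trapezoidal_kernel_uminus[OF h, of "- z"] grid by auto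
    thus "F z * trapezoidal_kernel h z = - F z - F z * trapezoidal_kernel h (- z)"
      by (simp only:) (simp add: right_diff_distrib)
  qed
  also have "\<dots> = - contour_integral (linepath a b) F
      - contour_integral (linepath a b) (\<lambda>z. F z * trapezoidal_kernel h (- z))"
    using F holomorphic_on_imp_continuous_on[OF holomorphic_on_trapezoidal_kernel_uminus[OF h grid]]
    by (subst contour_integral_diff)
       (auto intro!: contour_integrable_continuous_linepath continuous_intros contour_integral_neg)
  finally show ?thesis .
qed

text \<open>
  On the lower edge the kernel is \<open>- 1\<close> minus its reflection, which is small there. Cauchy's theorem
  on the lower half of the rectangle moves the resulting integral of \<open>F\<close> to the real axis.
\<close>

lemma trapezoidal_error_eq_contour_integrals:
  fixes F :: "complex \<Rightarrow> complex" and m :: nat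
  assumes F: "F holomorphic_on strip d" and \<delta>: "0 < \<delta>" "\<delta> < d" and h: "0 < h"
    and X: "X = (of_nat m + 1 / 2) * h"
  defines "f \<equiv> \<lambda>z. F z * trapezoidal_kernel h z"
  shows "integral {-X..X} (\<lambda>x. F (of_real x)) - trapezoidal_sum h (-int m) (int m) F =
      contour_integral (vertical_line X (-\<delta>) 0) F
    - contour_integral (vertical_line (-X) (-\<delta>) 0) F
    + contour_integral (vertical_line X (-\<delta>) \<delta>) f
    - contour_integral (vertical_line (-X) (-\<delta>) \<delta>) f
    - contour_integral (horizontal_line (-X) X \<delta>) f
    - contour_integral (horizontal_line (-X) X (-\<delta>)) (\<lambda>z. F z * trapezoidal_kernel h (- z))"
proof -
  let ?seg = "closed_segment (Complex (-X) (-\<delta>)) (Complex X (-\<delta>))"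
  let ?lower = "contour_integral (horizontal_line (-X) X (-\<delta>))"
  have "0 < X" unfolding X using h by (intro mult_pos_pos) auto
  have half: "path_image (rectpath (Complex (-X) (-\<delta>)) (Complex X 0)) \<subseteq> strip d"
    using \<open>0 < X\<close> \<delta> by (subst path_image_rectpath) (auto simp: strip_def)
  have cont: "continuous_on A F" if "A \<subseteq> strip d" for A
    using F that by (blast intro: holomorphic_on_imp_continuous_on continuous_on_subset)
  have "contour_integral (rectpath (Complex (-X) (-\<delta>)) (Complex X 0)) F = 0"
    by (rule contour_integral_unique, rule Cauchy_theorem_convex_simple[OF F convex_strip _ half]) auto
  hence cauchy: "?lower F + contour_integral (vertical_line X (-\<delta>) 0) F
      - integral {-X..X} (\<lambda>x. F (of_real x))
      - contour_integral (vertical_line (-X) (-\<delta>) 0) F = 0"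
    using \<open>0 < X\<close>
    by (simp add: contour_integral_rectpath[OF cont[OF half]] contour_integral_horizontal_line
        complex_of_real_def)
  have "?seg \<subseteq> strip d" "?seg \<inter> grid h = {}"
    using \<delta> by (auto simp: closed_segment_same_Im strip_def grid_def)
  hence reflection: "?lower f = - ?lower F - ?lower (\<lambda>z. F z * trapezoidal_kernel h (- z))"
    unfolding f_def by (intro contour_integral_mult_trapezoidal_kernel h cont)
  have "- trapezoidal_sum h (-int m) (int m) F = ?lower f
      + contour_integral (vertical_line X (-\<delta>) \<delta>) f
      - contour_integral (horizontal_line (-X) X \<delta>) f
      - contour_integral (vertical_line (-X) (-\<delta>) \<delta>) f"
    using contour_integral_rectpath[OF rectpath_trapezoidal_kernel(1)[OF F \<delta> h X]]
      rectpath_trapezoidal_kernel(2)[OF F \<delta> h X] by (simp only: f_def)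
  with cauchy reflection show ?thesis by algebra
qed

context
  fixes F :: "complex \<Rightarrow> complex" and G :: "real \<Rightarrow> real" and d \<delta> h :: real
  assumes F: "F holomorphic_on strip d" and \<delta>: "0 < \<delta>" "\<delta> < d" and h: "0 < h"
    and bound: "\<And>z. z \<in> strip d \<Longrightarrow> norm (F z) \<le> G (Re z)"
begin

lemma norm_contour_integral_half_integer_line_le:
  assumes x: "x = (of_int k + 1 / 2) * h"
  shows "norm (contour_integral (vertical_line x (-\<delta>) 0) F) \<le> G x * \<delta>"
    and "norm (contour_integral (vertical_line x (-\<delta>) \<delta>) (\<lambda>z. F z * trapezoidal_kernel h z))
      \<le> G x * (2 * \<delta>)"
proof -
  let ?f = "\<lambda>z. F z * trapezoidal_kernel h z"
  have norm_F: "norm (F (Complex x y)) \<le> G x" if "y \<in> {-\<delta>..\<delta>}" for y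
    using bound[of "Complex x y"] that \<delta> by (auto simp: strip_def)
  have cont: "continuous_on (closed_segment (Complex x a) (Complex x b)) F"
    "continuous_on (closed_segment (Complex x a) (Complex x b)) ?f"
    if "-\<delta> \<le> a" "a \<le> b" "b \<le> \<delta>" for a b
  proof -
    have segment: "closed_segment (Complex x a) (Complex x b) \<subseteq> strip d - grid h"
    proof
      fix z assume "z \<in> closed_segment (Complex x a) (Complex x b)"
      hence "z = Complex x (Im z)" "Im z \<in> {a..b}"
        using that by (auto simp: closed_segment_same_Re closed_segment_eq_real_ivl complex_eq_iff)
      thus "z \<in> strip d - grid h"
        using that \<delta> half_integer_notin_grid[OF h, of k "Im z"] by (auto simp: strip_def x)
    qed
    have "F holomorphic_on strip d - grid h" "?f holomorphic_on strip d - grid h"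
      using h by (auto intro!: holomorphic_on_mult holomorphic_on_trapezoidal_kernel
          holomorphic_on_subset[OF F])
    thus "continuous_on (closed_segment (Complex x a) (Complex x b)) F"
      "continuous_on (closed_segment (Complex x a) (Complex x b)) ?f"
      using segment holomorphic_on_imp_continuous_on continuous_on_subset by blast+
  qed
  show "norm (contour_integral (vertical_line x (-\<delta>) 0) F) \<le> G x * \<delta>"
    using norm_contour_integral_vertical_line_le[OF _ cont(1), of "-\<delta>" 0 "G x"] norm_F \<delta> by simp
  have "norm (?f (Complex x y)) \<le> G x" if "y \<in> {-\<delta>..\<delta>}" for y
    using mult_mono[OF norm_F[OF that] norm_trapezoidal_kernel_half_integer_le[OF h, of k y]]
      order_trans[OF norm_ge_zero norm_F[OF that]] by (simp add: norm_mult x)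
  thus "norm (contour_integral (vertical_line x (-\<delta>) \<delta>) ?f) \<le> G x * (2 * \<delta>)"
    using norm_contour_integral_vertical_line_le[OF _ cont(2), of "-\<delta>" \<delta> "G x"] \<delta> by simp
qed

lemma norm_contour_integral_horizontal_edge_le:
  assumes "0 < X" and G: "G integrable_on {-X..X}"
  shows "norm (contour_integral (horizontal_line (-X) X \<delta>) (\<lambda>z. F z * trapezoidal_kernel h z))
      \<le> 1 / (exp (2 * pi * \<delta> / h) - 1) * integral {-X..X} G"
    and "norm (contour_integral (horizontal_line (-X) X (-\<delta>))
        (\<lambda>z. F z * trapezoidal_kernel h (- z))) \<le> 1 / (exp (2 * pi * \<delta> / h) - 1) * integral {-X..X} G"
proof -
  let ?c = "1 / (exp (2 * pi * \<delta> / h) - 1)"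
  have edge: "norm (contour_integral (horizontal_line (-X) X y) (\<lambda>z. F z * \<kappa> z))
      \<le> ?c * integral {-X..X} G"
    if "\<bar>y\<bar> = \<delta>" and \<kappa>: "\<kappa> holomorphic_on - grid h" "\<And>x. norm (\<kappa> (Complex x y)) \<le> ?c" for y \<kappa>
  proof -
    have "closed_segment (Complex (-X) y) (Complex X y) \<subseteq> strip d - grid h"
      using that(1) \<delta> by (auto simp: closed_segment_same_Im strip_def grid_def)
    moreover have "(\<lambda>z. F z * \<kappa> z) holomorphic_on strip d - grid h"
      by (intro holomorphic_on_mult holomorphic_on_subset[OF F] holomorphic_on_subset[OF \<kappa>(1)]) auto
    ultimately have "continuous_on (closed_segment (Complex (-X) y) (Complex X y)) (\<lambda>z. F z * \<kappa> z)"
      using holomorphic_on_imp_continuous_on continuous_on_subset by blast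
    moreover have "norm (F (Complex x y) * \<kappa> (Complex x y)) \<le> ?c * G x" for x
      using mult_mono[OF \<kappa>(2)[of x] bound[of "Complex x y"]] that(1) \<delta> h
      by (simp add: norm_mult mult.commute strip_def)
    ultimately have "norm (contour_integral (horizontal_line (-X) X y) (\<lambda>z. F z * \<kappa> z))
        \<le> integral {-X..X} (\<lambda>x. ?c * G x)"
      using \<open>0 < X\<close>
      by (intro norm_contour_integral_horizontal_line_le integrable_on_mult_right G) auto
    thus ?thesis by simp
  qed
  have "trapezoidal_kernel h holomorphic_on - grid h"
    "(\<lambda>z. trapezoidal_kernel h (- z)) holomorphic_on - grid h"
    using h holomorphic_on_trapezoidal_kernel holomorphic_on_trapezoidal_kernel_uminus by blast+
  thus "norm (contour_integral (horizontal_line (-X) X \<delta>)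
        (\<lambda>z. F z * trapezoidal_kernel h z)) \<le> ?c * integral {-X..X} G"
      "norm (contour_integral (horizontal_line (-X) X (-\<delta>))
        (\<lambda>z. F z * trapezoidal_kernel h (- z))) \<le> ?c * integral {-X..X} G"
    using \<delta> norm_trapezoidal_kernel_le[OF h, of "Complex _ \<delta>"]
      norm_trapezoidal_kernel_le[OF h, of "- Complex _ (-\<delta>)"] by (intro edge; simp)+
qed

lemma trapezoidal_rectangle_error:
  fixes m :: nat
  assumes X: "X = (of_nat m + 1 / 2) * h" and G: "G integrable_on {-X..X}"
  shows "norm (integral {-X..X} (\<lambda>x. F (of_real x)) - trapezoidal_sum h (-int m) (int m) F)
    \<le> 2 / (exp (2 * pi * \<delta> / h) - 1) * integral {-X..X} G + 3 * \<delta> * (G X + G (-X))"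
proof -
  have "0 < X" unfolding X using h by (intro mult_pos_pos) auto
  have "X = (of_int (int m) + 1 / 2) * h" "-X = (of_int (- int m - 1) + 1 / 2) * h"
    by (simp_all add: X algebra_simps)
  note vertical = this[THEN norm_contour_integral_half_integer_line_le(1)]
    this[THEN norm_contour_integral_half_integer_line_le(2)]
  have "norm (a - b + c - e - t - l) \<le> norm a + norm b + norm c + norm e + norm t + norm l"
    for a b c e t l :: complex by norm
  hence "norm (integral {-X..X} (\<lambda>x. F (of_real x)) - trapezoidal_sum h (-int m) (int m) F)
      \<le> G X * \<delta> + G (-X) * \<delta> + G X * (2 * \<delta>) + G (-X) * (2 * \<delta>)
        + 1 / (exp (2 * pi * \<delta> / h) - 1) * integral {-X..X} G
        + 1 / (exp (2 * pi * \<delta> / h) - 1) * integral {-X..X} G"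
    unfolding trapezoidal_error_eq_contour_integrals[OF F \<delta> h X]
    by (rule order_trans)
       (intro add_mono vertical norm_contour_integral_horizontal_edge_le[OF \<open>0 < X\<close> G])
  also have "\<dots> = 2 / (exp (2 * pi * \<delta> / h) - 1) * integral {-X..X} G + 3 * \<delta> * (G X + G (-X))"
    by (simp add: algebra_simps)
  finally show ?thesis .
qed

end

lemma tendsto_integral_symmetric_interval:
  fixes f :: "real \<Rightarrow> 'a::banach"
  assumes "f integrable_on UNIV" and X: "filterlim X at_top A"
  shows "((\<lambda>m. integral {- X m..X m} f) \<longlongrightarrow> integral UNIV f) A"
proof (rule tendstoI)
  fix e :: real assume "0 < e"
  have "\<nexists>a b. (UNIV :: real set) = cbox a b"
    by (metis bounded_cbox not_bounded_UNIV)
  then obtain B where B: "\<forall>a b. ball 0 B \<subseteq> cbox a b \<longrightarrow>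
      (\<exists>z. ((\<lambda>x. if x \<in> UNIV then f x else 0) has_integral z) (cbox a b) \<and> norm (z - integral UNIV f) < e)"
    by (rule has_integral_altD[OF integrable_integral[OF assms(1)] _ \<open>0 < e\<close>])
  have "eventually (\<lambda>m. B \<le> X m) A"
    using X by (simp add: filterlim_at_top)
  thus "eventually (\<lambda>m. dist (integral {- X m..X m} f) (integral UNIV f) < e) A"
  proof eventually_elim
    fix m assume "B \<le> X m"
    hence "ball 0 B \<subseteq> cbox (- X m) (X m)" by (auto simp: ball_def dist_real_def)
    with B obtain z where "((\<lambda>x. if x \<in> UNIV then f x else 0) has_integral z) (cbox (- X m) (X m))"
        "norm (z - integral UNIV f) < e"
      by meson
    thus "dist (integral {- X m..X m} f) (integral UNIV f) < e"
      by (simp add: dist_norm integral_unique)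
  qed
qed

lemma has_sum_imp_tendsto_symmetric_sum:
  fixes f :: "int \<Rightarrow> 'a::{topological_space, comm_monoid_add}"
  assumes "(f has_sum S) UNIV"
  shows "(\<lambda>m. \<Sum>k=-int m..int m. f k) \<longlonglongrightarrow> S"
proof -
  have "filterlim int at_top sequentially" by (rule filterlim_int_sequentially)
  moreover have "filterlim (\<lambda>m. - int m) at_bot sequentially"
    unfolding filterlim_at_bot
  proof
    fix Z
    show "\<forall>\<^sub>F m in sequentially. - int m \<le> Z"
      using eventually_ge_at_top[of "nat (- Z)"] by eventually_elim linarith
  qed
  ultimately have "filterlim (\<lambda>m. {-int m..int m}) finite_sets_at_top sequentially"
    by (intro filterlim_atLeastAtMost_at_bot_at_top) auto
  thus ?thesis
    using assms unfolding has_sum_def by (rule filterlim_compose[rotated])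
qed

lemma trapezoidal_strip_error:
  fixes F :: "complex \<Rightarrow> complex" and G :: "real \<Rightarrow> real"
  assumes F: "F holomorphic_on strip d" and \<delta>: "0 < \<delta>" "\<delta> < d" and h: "0 < h"
    and bound: "\<And>z. z \<in> strip d \<Longrightarrow> norm (F z) \<le> G (Re z)"
    and G: "G integrable_on UNIV" "(G \<longlongrightarrow> 0) at_top" "(G \<longlongrightarrow> 0) at_bot"
    and F_integrable: "(\<lambda>x. F (of_real x)) integrable_on UNIV"
    and S: "((\<lambda>k::int. F (of_real (of_int k * h))) has_sum S) UNIV"
  shows "norm (integral UNIV (\<lambda>x. F (of_real x)) - h * S)
    \<le> 2 / (exp (2 * pi * \<delta> / h) - 1) * integral UNIV G"
proof (rule LIMSEQ_le)
  let ?X = "\<lambda>m. (of_nat m + 1 / 2) * h" and ?c = "2 / (exp (2 * pi * \<delta> / h) - 1)"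
  have X: "filterlim ?X at_top sequentially"
    using h by real_asymp
  show "(\<lambda>m. norm (integral {- ?X m..?X m} (\<lambda>x. F (of_real x))
        - trapezoidal_sum h (-int m) (int m) F))
      \<longlonglongrightarrow> norm (integral UNIV (\<lambda>x. F (of_real x)) - h * S)"
    unfolding trapezoidal_sum_def
    by (intro tendsto_intros tendsto_integral_symmetric_interval has_sum_imp_tendsto_symmetric_sum
        F_integrable X S)
  have "(\<lambda>m. G (?X m)) \<longlonglongrightarrow> 0"
    by (rule filterlim_compose[OF G(2) X])
  moreover have "(\<lambda>m. G (- ?X m)) \<longlonglongrightarrow> 0"
    by (rule filterlim_compose[OF G(3) X[unfolded filterlim_uminus_at_top]])
  ultimately have "(\<lambda>m. ?c * integral {- ?X m..?X m} G + 3 * \<delta> * (G (?X m) + G (- ?X m)))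
      \<longlonglongrightarrow> ?c * integral UNIV G + 3 * \<delta> * (0 + 0)"
    by (intro tendsto_add tendsto_mult tendsto_const tendsto_integral_symmetric_interval G(1) X)
  thus "(\<lambda>m. ?c * integral {- ?X m..?X m} G + 3 * \<delta> * (G (?X m) + G (- ?X m)))
      \<longlonglongrightarrow> ?c * integral UNIV G" by simp
  have "G integrable_on {- ?X m..?X m}" for m
    using G(1) by (rule integrable_on_subinterval) simp
  thus "\<exists>m0. \<forall>m\<ge>m0. norm (integral {- ?X m..?X m} (\<lambda>x. F (of_real x))
        - trapezoidal_sum h (-int m) (int m) F)
      \<le> ?c * integral {- ?X m..?X m} G + 3 * \<delta> * (G (?X m) + G (- ?X m))"
    using trapezoidal_rectangle_error[OF F \<delta> h bound refl] by blast
qed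

lemma trapezoidal_rule_error:
  fixes F :: "complex \<Rightarrow> complex" and G :: "real \<Rightarrow> real"
  assumes F: "F holomorphic_on strip d" and d: "0 < d" and h: "0 < h"
    and bound: "\<And>z. z \<in> strip d \<Longrightarrow> norm (F z) \<le> G (Re z)"
    and G: "G integrable_on UNIV" "(G \<longlongrightarrow> 0) at_top" "(G \<longlongrightarrow> 0) at_bot"
    and F_integrable: "(\<lambda>x. F (of_real x)) integrable_on UNIV"
    and S: "((\<lambda>k::int. F (of_real (of_int k * h))) has_sum S) UNIV"
  shows "norm (integral UNIV (\<lambda>x. F (of_real x)) - h * S)
    \<le> 2 / (exp (2 * pi * d / h) - 1) * integral UNIV G"
proof (rule tendsto_lowerbound)
  show "((\<lambda>\<delta>. 2 / (exp (2 * pi * \<delta> / h) - 1) * integral UNIV G)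
      \<longlongrightarrow> 2 / (exp (2 * pi * d / h) - 1) * integral UNIV G) (at_left d)"
    using d h by (intro tendsto_intros) auto
  show "\<forall>\<^sub>F \<delta> in at_left d. norm (integral UNIV (\<lambda>x. F (of_real x)) - h * S)
      \<le> 2 / (exp (2 * pi * \<delta> / h) - 1) * integral UNIV G"
    using eventually_at_left_real[OF d]
    by eventually_elim (rule trapezoidal_strip_error[OF F _ _ h bound G F_integrable S], auto)
qed simp

subsection \<open>Exponentially decaying integrands\<close>

definition exp_decay :: "real \<Rightarrow> real \<Rightarrow> real \<Rightarrow> real" where
  "exp_decay \<alpha> \<beta> x = exp (min (\<alpha> * x) (- \<beta> * x))"

lemma exp_decay_le: "exp_decay \<alpha> \<beta> x \<le> exp (\<alpha> * x)" "exp_decay \<alpha> \<beta> x \<le> exp (- \<beta> * x)"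
  by (simp_all add: exp_decay_def)

lemma tendsto_exp_decay:
  assumes "0 < \<alpha>" "0 < \<beta>"
  shows "(exp_decay \<alpha> \<beta> \<longlongrightarrow> 0) at_top" "(exp_decay \<alpha> \<beta> \<longlongrightarrow> 0) at_bot"
proof -
  have "((\<lambda>x. exp (- \<beta> * x)) \<longlongrightarrow> 0) at_top"
    using assms by real_asymp
  thus "(exp_decay \<alpha> \<beta> \<longlongrightarrow> 0) at_top"
    by (rule tendsto_sandwich[OF _ _ tendsto_const, rotated 2]) (auto simp: exp_decay_def)
  have "((\<lambda>x. exp (\<alpha> * x)) \<longlongrightarrow> 0) at_bot"
    using assms by real_asymp
  thus "(exp_decay \<alpha> \<beta> \<longlongrightarrow> 0) at_bot"
    by (rule tendsto_sandwich[OF _ _ tendsto_const, rotated 2]) (auto simp: exp_decay_def)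
qed

lemma has_integral_exp_decay:
  assumes "0 < \<alpha>" "0 < \<beta>"
  shows "(exp_decay \<alpha> \<beta> has_integral 1 / \<alpha> + 1 / \<beta>) UNIV"
proof -
  have half: "(exp_decay a b has_integral 1 / b) {0..}" if "0 < a" "0 < b" for a b
  proof (rule has_integral_eq)
    show "((\<lambda>x. exp (- b * x)) has_integral 1 / b) {0..}"
      using has_integral_exp_minus_to_infinity[OF \<open>0 < b\<close>, of 0] by simp
    show "exp (- b * x) = exp_decay a b x" if "x \<in> {0..}" for x
    proof -
      have "- b * x \<le> 0" "0 \<le> a * x" using that \<open>0 < a\<close> \<open>0 < b\<close> by auto
      thus ?thesis by (simp add: exp_decay_def min_def)
    qed
  qed
  have "exp_decay \<beta> \<alpha> absolutely_integrable_on {0..}"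
    using half[OF assms(2,1)]
    by (intro nonnegative_absolutely_integrable_1) (auto simp: exp_decay_def)
  hence "(\<lambda>x. exp_decay \<beta> \<alpha> (- x)) absolutely_integrable_on {..0} \<and>
      integral {..0} (\<lambda>x. exp_decay \<beta> \<alpha> (- x)) = 1 / \<alpha>"
    using half[OF assms(2,1)] by (subst has_absolute_integral_reflect_real[of _ "{0..}"]) auto
  moreover have "exp_decay \<beta> \<alpha> (- x) = exp_decay \<alpha> \<beta> x" for x
    by (simp add: exp_decay_def min.commute)
  ultimately have "(exp_decay \<alpha> \<beta> has_integral 1 / \<alpha>) {..0}"
    by (simp add: has_integral_iff set_lebesgue_integral_eq_integral(1))
  moreover have "negligible ({..0} \<inter> {0..} :: real set)"
    by (rule negligible_subset[of "{0}"]) auto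
  ultimately have "(exp_decay \<alpha> \<beta> has_integral 1 / \<alpha> + 1 / \<beta>) ({..0} \<union> {0..})"
    using half[OF assms] by (intro has_integral_Un)
  moreover have "{..0} \<union> {0..} = (UNIV :: real set)" by auto
  ultimately show ?thesis by simp
qed

lemma has_sum_exp_tail:
  fixes b h :: real
  assumes "0 < b * h"
  shows "((\<lambda>k. exp (- b * (of_int k * h))) has_sum
    exp (- b * (of_int N * h)) / (exp (b * h) - 1)) {N<..}"
proof -
  let ?q = "exp (- (b * h))"
  have "?q < 1" using assms by simp
  hence "((\<lambda>n. exp (- b * (of_int N * h)) * ?q ^ n) has_sum
      exp (- b * (of_int N * h)) * (?q / (1 - ?q))) {1..}"
    by (intro has_sum_cmult_right has_sum_geometric_from_1) simp
  moreover have "?q / (1 - ?q) = 1 / (exp (b * h) - 1)"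
    using assms by (simp add: exp_minus field_simps)
  moreover have "exp (- b * (of_int N * h)) * ?q ^ n = exp (- b * (of_int (N + int n) * h))" for n
    by (simp add: algebra_simps flip: exp_of_nat_mult exp_add)
  ultimately have "((\<lambda>n. exp (- b * (of_int (N + int n) * h))) has_sum
      exp (- b * (of_int N * h)) / (exp (b * h) - 1)) {1..}"
    by simp
  also have "?this \<longleftrightarrow> ?thesis"
    by (intro has_sum_reindex_bij_witness[of _ "\<lambda>k. nat (k - N)" "\<lambda>n. N + int n"]) auto
  finally show ?thesis .
qed

lemma exp_bounded_tail:
  fixes f :: "int \<Rightarrow> 'a::banach" and b h :: real
  assumes pos: "0 < b" "0 < h"
    and bound: "\<And>k. k \<in> {N<..} \<Longrightarrow> norm (f k) \<le> B * exp (- b * (of_int k * h))"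
  obtains T where "(f has_sum T) {N<..}" "h * norm T \<le> B * (exp (- b * (of_int N * h)) / b)"
proof -
  let ?e = "\<lambda>k. exp (- b * (of_int k * h))"
  have geometric: "((\<lambda>k. B * ?e k) has_sum B * (?e N / (exp (b * h) - 1))) {N<..}"
    using pos by (intro has_sum_cmult_right has_sum_exp_tail) simp
  have norm_summable: "(\<lambda>k. norm (f k)) summable_on {N<..}"
    by (rule Infinite_Sum.abs_summable_on_comparison_test'[OF has_sum_imp_summable[OF geometric] bound])
  then obtain T where T: "(f has_sum T) {N<..}"
    using abs_summable_summable summable_on_def by blast
  have "norm T \<le> infsum (\<lambda>k. norm (f k)) {N<..}"
    using norm_summable T by (intro norm_has_sum_bound) auto
  also have "\<dots> \<le> B * (?e N / (exp (b * h) - 1))"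
    using norm_summable bound by (intro has_sum_mono[OF has_sum_infsum geometric]) auto
  finally have "h * norm T \<le> h * (B * (?e N / (exp (b * h) - 1)))"
    using pos by (intro mult_left_mono) auto
  also have "\<dots> = B * ?e N * (h / (exp (b * h) - 1))" by simp
  also have "\<dots> \<le> B * ?e N * (1 / b)"
  proof (rule mult_left_mono)
    show "h / (exp (b * h) - 1) \<le> 1 / b"
      using pos exp_ge_add_one_self[of "b * h"] by (simp add: field_simps add_increasing)
    have "0 \<le> B * ?e (N + 1)" using bound[of "N + 1"] by (auto intro: order_trans[OF norm_ge_zero])
    thus "0 \<le> B * ?e N" by (simp add: zero_le_mult_iff)
  qed
  finally show ?thesis using T that by simp
qed

lemma bilateral_truncation_error:
  fixes f :: "int \<Rightarrow> 'a::{banach, real_normed_field}" and \<alpha> \<beta> h :: real and M N :: int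
  assumes pos: "0 < \<alpha>" "0 < \<beta>" "0 < h" "0 \<le> M" "0 \<le> N"
    and bound: "\<And>k. norm (f k) \<le> B * exp_decay \<alpha> \<beta> (of_int k * h)"
  obtains S where "(f has_sum S) UNIV"
    "norm (of_real h * S - of_real h * (\<Sum>k=-M..N. f k))
      \<le> B * (exp (- \<alpha> * (of_int M * h)) / \<alpha> + exp (- \<beta> * (of_int N * h)) / \<beta>)"
proof -
  have "0 \<le> B" using bound[of 0] by (simp add: exp_decay_def order_trans[OF norm_ge_zero])
  hence bounds: "norm (f k) \<le> B * exp (- \<beta> * (of_int k * h))"
      "norm (f (- k)) \<le> B * exp (- \<alpha> * (of_int k * h))" for k
    using bound[of k] bound[of "- k"] exp_decay_le(2)[of \<alpha> \<beta> "of_int k * h"]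
      exp_decay_le(1)[of \<alpha> \<beta> "of_int (- k) * h"]
    by (auto elim!: order_trans intro!: mult_left_mono)
  obtain U where U: "(f has_sum U) {N<..}" "h * norm U \<le> B * (exp (- \<beta> * (of_int N * h)) / \<beta>)"
    using exp_bounded_tail[OF pos(2,3) bounds(1)] by blast
  obtain L where L: "((\<lambda>k. f (- k)) has_sum L) {M<..}"
      "h * norm L \<le> B * (exp (- \<alpha> * (of_int M * h)) / \<alpha>)"
    using exp_bounded_tail[OF pos(1,3) bounds(2)] by blast
  have "(f has_sum L) {..<-M}"
    using L(1)
    by (subst has_sum_reindex_bij_witness[of _ uminus uminus "{M<..}" "\<lambda>k. f (- k)" f]) auto
  moreover have "(f has_sum (\<Sum>k=-M..N. f k)) {-M..N}" by simp
  ultimately have "(f has_sum L + (\<Sum>k=-M..N. f k) + U) ({..<-M} \<union> {-M..N} \<union> {N<..})"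
    using pos U(1) by (intro has_sum_Un_disjoint) auto
  moreover have "{..<-M} \<union> {-M..N} \<union> {N<..} = UNIV" by auto
  moreover have "norm (of_real h * (L + (\<Sum>k=-M..N. f k) + U) - of_real h * (\<Sum>k=-M..N. f k))
      \<le> h * norm L + h * norm U"
    using pos(3) norm_triangle_ineq[of "of_real h * L" "of_real h * U"]
    by (simp add: algebra_simps norm_mult)
  ultimately show ?thesis
    using U(2) L(2) that[of "L + (\<Sum>k=-M..N. f k) + U"] by (simp add: algebra_simps)
qed

lemma absolutely_integrable_exp_decay_bound:
  fixes F :: "complex \<Rightarrow> complex"
  assumes F: "F holomorphic_on strip d" and "0 < d" "0 < \<alpha>" "0 < \<beta>"
    and bound: "\<And>x. norm (F (of_real x)) \<le> B * exp_decay \<alpha> \<beta> x"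
  shows "(\<lambda>x. F (of_real x)) absolutely_integrable_on UNIV"
proof (rule measurable_bounded_by_integrable_imp_absolutely_integrable)
  have "continuous_on UNIV (\<lambda>x. F (of_real x))"
    by (rule continuous_on_compose2[OF holomorphic_on_imp_continuous_on[OF F]])
       (use \<open>0 < d\<close> in \<open>auto simp: strip_def intro!: continuous_intros\<close>)
  thus "(\<lambda>x. F (of_real x)) \<in> borel_measurable (lebesgue_on UNIV)"
    by (intro continuous_imp_measurable_on_sets_lebesgue) auto
  show "(\<lambda>x. B * exp_decay \<alpha> \<beta> x) integrable_on UNIV"
    using has_integral_exp_decay[OF assms(3,4)] by (intro integrable_on_mult_right) auto
qed (use bound in auto)

lemma sinc_quadrature_error:
  fixes F :: "complex \<Rightarrow> complex" and M N :: int
  assumes F: "F holomorphic_on strip d" and pos: "0 < d" "0 < h" "0 < \<alpha>" "0 < \<beta>" "0 \<le> M" "0 \<le> N"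
    and bound: "\<And>z. z \<in> strip d \<Longrightarrow> norm (F z) \<le> A * exp_decay \<alpha> \<beta> (Re z)"
    and bound_real: "\<And>x. norm (F (of_real x)) \<le> B * exp_decay \<alpha> \<beta> x"
  shows "norm (integral UNIV (\<lambda>x. F (of_real x)) - trapezoidal_sum h (-M) N F)
      \<le> 2 / (exp (2 * pi * d / h) - 1) * (A * (1 / \<alpha> + 1 / \<beta>))
        + B * (exp (- \<alpha> * (of_int M * h)) / \<alpha> + exp (- \<beta> * (of_int N * h)) / \<beta>)"
proof -
  have decay: "((\<lambda>x. A * exp_decay \<alpha> \<beta> x) has_integral A * (1 / \<alpha> + 1 / \<beta>)) UNIV"
    using has_integral_exp_decay[OF pos(3,4)] by (rule has_integral_mult_right)
  have F_integrable: "(\<lambda>x. F (of_real x)) integrable_on UNIV"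
    using absolutely_integrable_exp_decay_bound[OF F pos(1,3,4) bound_real]
    by (rule set_lebesgue_integral_eq_integral(1))
  obtain S where S: "((\<lambda>k. F (of_real (of_int k * h))) has_sum S) UNIV"
    and truncation: "norm (of_real h * S - trapezoidal_sum h (-M) N F)
      \<le> B * (exp (- \<alpha> * (of_int M * h)) / \<alpha> + exp (- \<beta> * (of_int N * h)) / \<beta>)"
    unfolding trapezoidal_sum_def using bilateral_truncation_error[OF pos(3,4,2,5,6) bound_real]
    by blast
  have "((\<lambda>x. A * exp_decay \<alpha> \<beta> x) \<longlongrightarrow> A * 0) at_top" "((\<lambda>x. A * exp_decay \<alpha> \<beta> x) \<longlongrightarrow> A * 0) at_bot"
    by (intro tendsto_intros tendsto_exp_decay pos)+
  hence "norm (integral UNIV (\<lambda>x. F (of_real x)) - h * S)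
      \<le> 2 / (exp (2 * pi * d / h) - 1) * integral UNIV (\<lambda>x. A * exp_decay \<alpha> \<beta> x)"
    using has_integral_integrable[OF decay] F_integrable
    by (intro trapezoidal_rule_error[OF F pos(1,2) bound _ _ _ _ S]) auto
  also have "integral UNIV (\<lambda>x. A * exp_decay \<alpha> \<beta> x) = A * (1 / \<alpha> + 1 / \<beta>)"
    using decay by (rule integral_unique)
  finally show "norm (integral UNIV (\<lambda>x. F (of_real x)) - trapezoidal_sum h (-M) N F)
      \<le> 2 / (exp (2 * pi * d / h) - 1) * (A * (1 / \<alpha> + 1 / \<beta>))
        + B * (exp (- \<alpha> * (of_int M * h)) / \<alpha> + exp (- \<beta> * (of_int N * h)) / \<beta>)"
    using truncation norm_triangle_ineq[of "integral UNIV (\<lambda>x. F (of_real x)) - of_real h * S"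
        "of_real h * S - trapezoidal_sum h (-M) N F"] by simp
qed

definition balanced_step :: "real \<Rightarrow> real \<Rightarrow> nat \<Rightarrow> real" where
  "balanced_step d \<mu> n = sqrt (2 * pi * d / (\<mu> * real n))"

definition left_cutoff :: "real \<Rightarrow> real \<Rightarrow> nat \<Rightarrow> int" where
  "left_cutoff \<alpha> \<beta> n = (if min \<alpha> \<beta> = \<alpha> then int n else \<lceil>\<beta> * real n / \<alpha>\<rceil>)"

definition right_cutoff :: "real \<Rightarrow> real \<Rightarrow> nat \<Rightarrow> int" where
  "right_cutoff \<alpha> \<beta> n = (if min \<alpha> \<beta> = \<alpha> then \<lceil>\<alpha> * real n / \<beta>\<rceil> else int n)"

lemma balanced_step:
  fixes n :: nat
  assumes "0 < d" "0 < \<mu>" "0 < n"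
  shows "0 < balanced_step d \<mu> n"
    and "\<mu> * real n * balanced_step d \<mu> n = sqrt (2 * pi * d * \<mu> * real n)"
    and "2 * pi * d / balanced_step d \<mu> n = sqrt (2 * pi * d * \<mu> * real n)"
proof -
  define h where "h = balanced_step d \<mu> n"
  have "0 < h" unfolding h_def balanced_step_def using assms by simp
  have square: "h\<^sup>2 = 2 * pi * d / (\<mu> * real n)" using assms by (simp add: h_def balanced_step_def)
  have "(\<mu> * real n * h)\<^sup>2 = 2 * pi * d * \<mu> * real n"
    unfolding power_mult_distrib square using assms by (simp add: field_simps power2_eq_square)
  hence step: "\<mu> * real n * h = sqrt (2 * pi * d * \<mu> * real n)"
    using assms \<open>0 < h\<close> by (intro real_sqrt_unique[symmetric]) auto
  have "2 * pi * d = \<mu> * real n * h * h"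
    using square assms by (simp add: field_simps power2_eq_square)
  hence "2 * pi * d / h = \<mu> * real n * h" using \<open>0 < h\<close> by simp
  with step \<open>0 < h\<close> show "0 < balanced_step d \<mu> n"
    "\<mu> * real n * balanced_step d \<mu> n = sqrt (2 * pi * d * \<mu> * real n)"
    "2 * pi * d / balanced_step d \<mu> n = sqrt (2 * pi * d * \<mu> * real n)"
    by (simp_all only: h_def)
qed

lemma le_mult_ceiling_divide: "0 < a \<Longrightarrow> b \<le> a * of_int \<lceil>b / a\<rceil>" for a b :: real
  using le_of_int_ceiling[of "b / a"] by (simp only: pos_divide_le_eq mult.commute)

lemma left_cutoff:
  assumes "0 < \<alpha>" "0 < \<beta>"
  shows "0 \<le> left_cutoff \<alpha> \<beta> n" "min \<alpha> \<beta> * real n \<le> \<alpha> * of_int (left_cutoff \<alpha> \<beta> n)"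
proof -
  have "0 \<le> \<beta> * real n / \<alpha>" using assms by simp
  hence "0 \<le> \<lceil>\<beta> * real n / \<alpha>\<rceil>" by simp
  thus "0 \<le> left_cutoff \<alpha> \<beta> n" by (simp add: left_cutoff_def)
  show "min \<alpha> \<beta> * real n \<le> \<alpha> * of_int (left_cutoff \<alpha> \<beta> n)"
    using le_mult_ceiling_divide[OF assms(1)] by (auto simp: left_cutoff_def min_def)
qed

lemma right_cutoff:
  assumes "0 < \<alpha>" "0 < \<beta>"
  shows "0 \<le> right_cutoff \<alpha> \<beta> n" "min \<alpha> \<beta> * real n \<le> \<beta> * of_int (right_cutoff \<alpha> \<beta> n)"
proof -
  have "0 \<le> \<alpha> * real n / \<beta>" using assms by simp
  hence "0 \<le> \<lceil>\<alpha> * real n / \<beta>\<rceil>" by simp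
  thus "0 \<le> right_cutoff \<alpha> \<beta> n" by (simp add: right_cutoff_def)
  show "min \<alpha> \<beta> * real n \<le> \<beta> * of_int (right_cutoff \<alpha> \<beta> n)"
    using le_mult_ceiling_divide[OF assms(2)] by (auto simp: right_cutoff_def min_def)
qed

lemma balanced_sinc_quadrature_error:
  fixes F :: "complex \<Rightarrow> complex" and n :: nat
  assumes F: "F holomorphic_on strip d" and pos: "0 < d" "0 < \<alpha>" "0 < \<beta>" "0 < n" "0 \<le> A" "0 \<le> B"
    and bound: "\<And>z. z \<in> strip d \<Longrightarrow> norm (F z) \<le> A * exp_decay \<alpha> \<beta> (Re z)"
    and bound_real: "\<And>x. norm (F (of_real x)) \<le> B * exp_decay \<alpha> \<beta> x"
  defines "\<mu> \<equiv> min \<alpha> \<beta>"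
  shows "norm (integral UNIV (\<lambda>x. F (of_real x))
        - trapezoidal_sum (balanced_step d \<mu> n) (- left_cutoff \<alpha> \<beta> n) (right_cutoff \<alpha> \<beta> n) F)
      \<le> 2 / \<mu> * (2 * A / (1 - exp (- sqrt (2 * pi * d * \<mu>))) + B)
        * exp (- sqrt (2 * pi * d * \<mu> * real n))"
proof -
  define h M N where "h = balanced_step d \<mu> n" and "M = left_cutoff \<alpha> \<beta> n" and "N = right_cutoff \<alpha> \<beta> n"
  let ?L = "sqrt (2 * pi * d * \<mu> * real n)" and ?r = "exp (- sqrt (2 * pi * d * \<mu>))"
  have \<mu>: "0 < \<mu>" "\<mu> \<le> \<alpha>" "\<mu> \<le> \<beta>" using pos by (auto simp: \<mu>_def)
  note h = balanced_step[OF pos(1) \<mu>(1) pos(4), folded h_def M_def N_def]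
  note M = left_cutoff[OF pos(2,3), of n, folded \<mu>_def h_def M_def N_def]
    and N = right_cutoff[OF pos(2,3), of n, folded \<mu>_def h_def M_def N_def]
  have tails: "exp (- \<alpha> * (of_int M * h)) \<le> exp (- ?L)" "exp (- \<beta> * (of_int N * h)) \<le> exp (- ?L)"
    using M(2)[THEN mult_right_mono, OF less_imp_le[OF h(1)]]
      N(2)[THEN mult_right_mono, OF less_imp_le[OF h(1)]]
    unfolding h(2) by (simp_all add: mult.assoc)
  have reciprocals: "1 / \<alpha> + 1 / \<beta> \<le> 2 / \<mu>"
    using divide_left_mono[OF \<mu>(2), of 1] divide_left_mono[OF \<mu>(3), of 1] \<mu> pos by auto
  have "sqrt (2 * pi * d * \<mu>) \<le> ?L"
    using pos \<mu> mult_left_mono[of 1 "real n" "2 * pi * d * \<mu>"] by simp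
  hence r: "exp (- ?L) \<le> ?r" "?r < 1" using pos \<mu> by simp_all
  have "2 / (exp ?L - 1) * (A * (1 / \<alpha> + 1 / \<beta>)) \<le> 2 * (exp (- ?L) / (1 - ?r)) * (A * (2 / \<mu>))"
  proof -
    have "1 / (exp ?L - 1) = exp (- ?L) / (1 - exp (- ?L))" by (simp add: exp_minus field_simps)
    also have "\<dots> \<le> exp (- ?L) / (1 - ?r)" using r by (intro frac_le) auto
    finally have "2 / (exp ?L - 1) \<le> 2 * (exp (- ?L) / (1 - ?r))" by simp
    thus ?thesis using reciprocals r pos \<mu> by (intro mult_mono) auto
  qed
  moreover have "B * (exp (- \<alpha> * (of_int M * h)) / \<alpha> + exp (- \<beta> * (of_int N * h)) / \<beta>)
      \<le> B * (exp (- ?L) * (2 / \<mu>))"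
  proof (rule mult_left_mono)
    have "exp (- \<alpha> * (of_int M * h)) / \<alpha> + exp (- \<beta> * (of_int N * h)) / \<beta>
        \<le> exp (- ?L) / \<alpha> + exp (- ?L) / \<beta>"
      using tails pos by (intro add_mono divide_right_mono) auto
    also have "\<dots> = exp (- ?L) * (1 / \<alpha> + 1 / \<beta>)" by (simp add: distrib_left)
    also have "\<dots> \<le> exp (- ?L) * (2 / \<mu>)" using reciprocals by (intro mult_left_mono) auto
    finally show "exp (- \<alpha> * (of_int M * h)) / \<alpha> + exp (- \<beta> * (of_int N * h)) / \<beta>
        \<le> exp (- ?L) * (2 / \<mu>)" .
  qed (use pos in simp)
  ultimately have "norm (integral UNIV (\<lambda>x. F (of_real x)) - trapezoidal_sum h (-M) N F)
      \<le> 2 * (exp (- ?L) / (1 - ?r)) * (A * (2 / \<mu>)) + B * (exp (- ?L) * (2 / \<mu>))"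
    using sinc_quadrature_error[OF F pos(1) h(1) pos(2,3) M(1) N(1) bound bound_real]
    unfolding h(3) by linarith
  also have "\<dots> = 2 / \<mu> * (2 * A / (1 - ?r) + B) * exp (- ?L)" by (simp add: algebra_simps)
  finally show ?thesis unfolding h_def M_def N_def .
qed

subsection \<open>Quadrature on the half-line\<close>

definition halfline_map :: "real \<Rightarrow> (complex \<Rightarrow> complex) \<Rightarrow> bool" where
  "halfline_map d \<Psi> \<longleftrightarrow> \<Psi> analytic_on strip d \<and>
     (\<exists>\<psi>. strict_mono \<psi> \<and> range \<psi> = {0<..} \<and> (\<forall>x. \<Psi> (of_real x) = of_real (\<psi> x)))"

lemma of_real_in_strip: "0 < d \<Longrightarrow> of_real x \<in> strip d"
  by (simp add: strip_def)

lemma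
  assumes "\<Psi> field_differentiable at (of_real x)" and real: "\<And>x. \<Psi> (of_real x) = of_real (\<psi> x)"
  shows has_real_derivative_restriction_to_reals:
      "(\<psi> has_real_derivative Re (deriv \<Psi> (of_real x))) (at x)"
    and deriv_real_on_reals: "deriv \<Psi> (of_real x) = of_real (Re (deriv \<Psi> (of_real x)))"
proof -
  have "(\<Psi> has_field_derivative deriv \<Psi> (of_real x)) (at (of_real x))"
    using assms(1) by (simp add: field_differentiable_derivI)
  hence "((\<lambda>x. \<Psi> (of_real x)) has_vector_derivative deriv \<Psi> (of_real x)) (at x)"
    by (rule has_vector_derivative_real_field)
  hence vector: "((\<lambda>x. of_real (\<psi> x)) has_vector_derivative deriv \<Psi> (of_real x)) (at x)"
    by (simp add: real)
  show "(\<psi> has_real_derivative Re (deriv \<Psi> (of_real x))) (at x)"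
    using bounded_linear.has_vector_derivative[OF bounded_linear_Re vector]
    by (simp add: has_real_derivative_iff_has_vector_derivative)
  have "((\<lambda>x. 0) has_vector_derivative Im (deriv \<Psi> (of_real x))) (at x)"
    using bounded_linear.has_vector_derivative[OF bounded_linear_Im vector] by simp
  hence "Im (deriv \<Psi> (of_real x)) = 0"
    using vector_derivative_unique_at has_vector_derivative_const by blast
  thus "deriv \<Psi> (of_real x) = of_real (Re (deriv \<Psi> (of_real x)))"
    by (simp add: complex_eq_iff)
qed

lemma halfline_map_substitution:
  fixes f :: "complex \<Rightarrow> complex"
  assumes "halfline_map d \<Psi>" "0 < d"
    and integrable: "(\<lambda>x. f (\<Psi> (of_real x)) * deriv \<Psi> (of_real x)) absolutely_integrable_on UNIV"
  shows "(\<lambda>t. f (of_real t)) integrable_on {0<..}"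
    and "integral {0<..} (\<lambda>t. f (of_real t)) =
      integral UNIV (\<lambda>x. f (\<Psi> (of_real x)) * deriv \<Psi> (of_real x))"
proof -
  obtain \<psi> where \<psi>: "strict_mono \<psi>" "range \<psi> = {0<..}" "\<And>x. \<Psi> (of_real x) = of_real (\<psi> x)"
    and \<Psi>: "\<Psi> analytic_on strip d"
    using assms(1) by (auto simp: halfline_map_def)
  define \<psi>' where "\<psi>' x = Re (deriv \<Psi> (of_real x))" for x
  have "\<Psi> field_differentiable at (of_real x)" for x
    using \<Psi> of_real_in_strip[OF \<open>0 < d\<close>] by (rule analytic_on_imp_differentiable_at)
  note \<psi>_deriv = has_real_derivative_restriction_to_reals[OF this \<psi>(3), folded \<psi>'_def]
    and \<Psi>_deriv = deriv_real_on_reals[OF this \<psi>(3), folded \<psi>'_def]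
  have "0 \<le> \<psi>' x" for x
    using \<psi>_deriv strict_mono_mono[OF \<psi>(1)] by (intro mono_on_imp_deriv_nonneg) auto
  hence "(\<lambda>x. \<bar>\<psi>' x\<bar> *\<^sub>R f (of_real (\<psi> x))) = (\<lambda>x. f (\<Psi> (of_real x)) * deriv \<Psi> (of_real x))"
    using \<Psi>_deriv by (simp add: \<psi>(3) scaleR_conv_of_real mult.commute)
  moreover have "(\<lambda>x. \<bar>\<psi>' x\<bar> *\<^sub>R f (of_real (\<psi> x))) absolutely_integrable_on UNIV \<and>
        integral UNIV (\<lambda>x. \<bar>\<psi>' x\<bar> *\<^sub>R f (of_real (\<psi> x))) = b \<longleftrightarrow>
      (\<lambda>t. f (of_real t)) absolutely_integrable_on range \<psi> \<and>
        integral (range \<psi>) (\<lambda>t. f (of_real t)) = b" for b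
    using \<psi>_deriv strict_mono_imp_inj_on[OF \<psi>(1)]
    by (intro has_absolute_integral_change_of_variables_real) auto
  ultimately show "(\<lambda>t. f (of_real t)) integrable_on {0<..}"
    "integral {0<..} (\<lambda>t. f (of_real t)) =
      integral UNIV (\<lambda>x. f (\<Psi> (of_real x)) * deriv \<Psi> (of_real x))"
    using integrable set_lebesgue_integral_eq_integral(1) unfolding \<psi>(2) by auto
qed

lemma halfline_quadrature_error:
  fixes f w \<Psi> :: "complex \<Rightarrow> complex" and n :: nat
  assumes \<Psi>: "halfline_map d \<Psi>" and f: "f analytic_on \<Psi> ` strip d"
    and pos: "0 < d" "0 < \<alpha>" "0 < \<beta>" "0 < n" "0 \<le> K" "0 \<le> A" "0 \<le> B"
    and f_le: "\<And>z. z \<in> \<Psi> ` strip d \<Longrightarrow> norm (f z) \<le> K * norm (w z)"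
    and w_le: "\<And>\<zeta>. \<zeta> \<in> strip d \<Longrightarrow> norm (w (\<Psi> \<zeta>)) * norm (deriv \<Psi> \<zeta>) \<le> A * exp_decay \<alpha> \<beta> (Re \<zeta>)"
    and w_le_real: "\<And>x. norm (w (\<Psi> (of_real x))) * norm (deriv \<Psi> (of_real x)) \<le> B * exp_decay \<alpha> \<beta> x"
  defines "\<mu> \<equiv> min \<alpha> \<beta>"
  shows "(\<lambda>t. f (of_real t)) integrable_on {0<..}"
    and "norm (integral {0<..} (\<lambda>t. f (of_real t))
        - trapezoidal_sum (balanced_step d \<mu> n) (- left_cutoff \<alpha> \<beta> n) (right_cutoff \<alpha> \<beta> n)
            (\<lambda>\<zeta>. f (\<Psi> \<zeta>) * deriv \<Psi> \<zeta>))
      \<le> 2 * K / \<mu> * (2 * A / (1 - exp (- sqrt (2 * pi * d * \<mu>))) + B)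
        * exp (- sqrt (2 * pi * d * \<mu> * real n))"
proof -
  let ?F = "\<lambda>\<zeta>. f (\<Psi> \<zeta>) * deriv \<Psi> \<zeta>"
  have \<Psi>_analytic: "\<Psi> analytic_on strip d" using \<Psi> by (simp add: halfline_map_def)
  have "?F analytic_on strip d"
    by (intro analytic_on_mult analytic_deriv \<Psi>_analytic
        analytic_on_compose[OF \<Psi>_analytic f, unfolded o_def])
  hence F: "?F holomorphic_on strip d" by (rule analytic_imp_holomorphic)
  have F_le: "norm (?F \<zeta>) \<le> K * (norm (w (\<Psi> \<zeta>)) * norm (deriv \<Psi> \<zeta>))" if "\<zeta> \<in> strip d" for \<zeta>
    using mult_right_mono[OF f_le[OF imageI[OF that]] norm_ge_zero]
    by (simp add: norm_mult mult.assoc)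
  have strip: "norm (?F \<zeta>) \<le> K * A * exp_decay \<alpha> \<beta> (Re \<zeta>)" if "\<zeta> \<in> strip d" for \<zeta>
    using order_trans[OF F_le[OF that] mult_left_mono[OF w_le[OF that] pos(5)]]
    by (simp only: mult.assoc)
  have real: "norm (?F (of_real x)) \<le> K * B * exp_decay \<alpha> \<beta> x" for x
    using order_trans[OF F_le[OF of_real_in_strip[OF pos(1)]] mult_left_mono[OF w_le_real pos(5)]]
    by (simp only: mult.assoc)
  have "(\<lambda>x. ?F (of_real x)) absolutely_integrable_on UNIV"
    by (rule absolutely_integrable_exp_decay_bound[OF F pos(1-3) real])
  note substitution = halfline_map_substitution[OF \<Psi> pos(1) this]
  show "(\<lambda>t. f (of_real t)) integrable_on {0<..}" by (rule substitution(1))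
  have "norm (integral UNIV (\<lambda>x. ?F (of_real x))
        - trapezoidal_sum (balanced_step d \<mu> n) (- left_cutoff \<alpha> \<beta> n) (right_cutoff \<alpha> \<beta> n) ?F)
      \<le> 2 / \<mu> * (2 * (K * A) / (1 - exp (- sqrt (2 * pi * d * \<mu>))) + K * B)
        * exp (- sqrt (2 * pi * d * \<mu> * real n))"
    unfolding \<mu>_def using pos by (intro balanced_sinc_quadrature_error[OF F] strip real) auto
  thus "norm (integral {0<..} (\<lambda>t. f (of_real t))
        - trapezoidal_sum (balanced_step d \<mu> n) (- left_cutoff \<alpha> \<beta> n) (right_cutoff \<alpha> \<beta> n) ?F)
      \<le> 2 * K / \<mu> * (2 * A / (1 - exp (- sqrt (2 * pi * d * \<mu>))) + B)
        * exp (- sqrt (2 * pi * d * \<mu> * real n))"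
    unfolding substitution(2) by (simp add: distrib_left mult.assoc mult.left_commute)
qed

subsection \<open>The weight for the exponential map\<close>

definition sector :: "real \<Rightarrow> complex set" where
  "sector \<kappa> = {w. w \<noteq> 0 \<and> \<kappa> * norm w \<le> Re w}"

lemma sector_Re_pos:
  assumes "0 < \<kappa>" "w \<in> sector \<kappa>"
  shows "0 < Re w"
  using assms by (auto simp: sector_def intro!: less_le_trans[of 0 "\<kappa> * norm w" "Re w"])

lemma exp_of_real_in_sector: "exp (of_real x) \<in> sector 1"
  by (simp add: sector_def exp_of_real)

lemma exp_strip_in_sector:
  assumes "\<zeta> \<in> strip d" "d \<le> pi"
  shows "exp \<zeta> \<in> sector (cos d)"
proof -
  have "cos d \<le> cos \<bar>Im \<zeta>\<bar>"
    using assms by (intro cos_monotone_0_pi_le) (auto simp: strip_def)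
  thus ?thesis by (simp add: sector_def Re_exp)
qed

lemma norm_one_plus_square_ge:
  assumes "w \<in> sector \<kappa>"
  shows "\<kappa> * (1 + (norm w)\<^sup>2) \<le> norm (1 + w\<^sup>2)"
proof -
  define a b where "a = Re w" and "b = Im w"
  have norms: "(norm w)\<^sup>2 = a\<^sup>2 + b\<^sup>2" "(norm (1 + w\<^sup>2))\<^sup>2 = (1 + a\<^sup>2 - b\<^sup>2)\<^sup>2 + (2 * a * b)\<^sup>2"
    unfolding cmod_power2 by (simp_all add: a_def b_def power2_eq_square algebra_simps)
  have "(a\<^sup>2 + b\<^sup>2) * ((1 + a\<^sup>2 - b\<^sup>2)\<^sup>2 + (2 * a * b)\<^sup>2) - ((1 + (a\<^sup>2 + b\<^sup>2)) * a)\<^sup>2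
      = (b * (1 - (a\<^sup>2 + b\<^sup>2)))\<^sup>2"
    by algebra
  hence "((1 + (norm w)\<^sup>2) * a)\<^sup>2 \<le> (norm w * norm (1 + w\<^sup>2))\<^sup>2"
    unfolding power_mult_distrib[of "norm w"] norms by (metis diff_ge_0_iff_ge zero_le_power2)
  hence "(1 + (norm w)\<^sup>2) * Re w \<le> norm w * norm (1 + w\<^sup>2)"
    unfolding a_def by (rule power2_le_imp_le) simp
  moreover have "(1 + (norm w)\<^sup>2) * (\<kappa> * norm w) \<le> (1 + (norm w)\<^sup>2) * Re w"
    using assms by (intro mult_left_mono) (auto simp: sector_def)
  ultimately have "norm w * (\<kappa> * (1 + (norm w)\<^sup>2)) \<le> norm w * norm (1 + w\<^sup>2)"
    by (simp add: mult_ac)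
  thus ?thesis using assms by (simp add: sector_def)
qed

lemma powr_one_plus_square_le_exp_decay:
  assumes "0 \<le> \<alpha> + \<beta>"
  shows "exp x powr \<alpha> / (1 + (exp x)\<^sup>2) powr ((\<alpha> + \<beta>) / 2) \<le> exp_decay \<alpha> \<beta> x"
proof -
  let ?W = "exp x" and ?p = "(\<alpha> + \<beta>) / 2"
  have bound: "?W powr \<alpha> / (1 + ?W\<^sup>2) powr ?p \<le> ?W powr \<alpha> / y powr ?p" if "0 < y" "y \<le> 1 + ?W\<^sup>2" for y
    using that assms by (intro divide_left_mono powr_mono2 mult_pos_pos) auto
  have "?W powr \<alpha> / (?W\<^sup>2) powr ?p = exp (\<alpha> * x - ?p * (2 * x))"
    by (simp add: powr_def ln_realpow exp_diff)
  also have "\<alpha> * x - ?p * (2 * x) = - \<beta> * x" by (simp add: algebra_simps)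
  finally have "?W powr \<alpha> / (1 + ?W\<^sup>2) powr ?p \<le> exp (- \<beta> * x)" using bound[of "?W\<^sup>2"] by simp
  moreover have "?W powr \<alpha> / (1 + ?W\<^sup>2) powr ?p \<le> exp (\<alpha> * x)"
    using bound[of 1] by (simp add: powr_def)
  ultimately show ?thesis by (simp add: exp_decay_def min_def)
qed

lemma norm_powr_of_real: "norm (z powr (of_real a :: complex)) = norm z powr a"
  by (simp add: norm_powr_real_powr')

lemma norm_E_2_mult:
  assumes "w \<noteq> 0"
  shows "norm (E 2 w \<alpha> \<beta>) * norm w = norm w powr \<alpha> / norm (1 + w\<^sup>2) powr ((\<alpha> + \<beta>) / 2)"
proof -
  have "norm (E 2 w \<alpha> \<beta>) = norm w powr (\<alpha> - 1) / norm (1 + w\<^sup>2) powr ((\<alpha> + \<beta>) / 2)"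
    by (simp only: E_def norm_mult norm_powr_of_real if_True refl minus_divide_left[symmetric]
        powr_minus_divide times_divide_eq_right mult_1_right)
  thus ?thesis using assms by (simp add: powr_diff)
qed

lemma E_2_le_exp_decay:
  assumes "exp \<zeta> \<in> sector \<kappa>" "0 < \<kappa>" "0 \<le> \<alpha> + \<beta>"
  shows "norm (E 2 (exp \<zeta>) \<alpha> \<beta>) * norm (exp \<zeta>) \<le> 1 / \<kappa> powr ((\<alpha> + \<beta>) / 2) * exp_decay \<alpha> \<beta> (Re \<zeta>)"
proof -
  let ?W = "exp (Re \<zeta>)" and ?p = "(\<alpha> + \<beta>) / 2"
  have pos: "0 < \<kappa> * (1 + ?W\<^sup>2)" using assms(2) by (intro mult_pos_pos add_pos_pos) auto
  have le: "\<kappa> * (1 + ?W\<^sup>2) \<le> norm (1 + (exp \<zeta>)\<^sup>2)"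
    using norm_one_plus_square_ge[OF assms(1)] by simp
  have "norm (E 2 (exp \<zeta>) \<alpha> \<beta>) * norm (exp \<zeta>) = ?W powr \<alpha> / norm (1 + (exp \<zeta>)\<^sup>2) powr ?p"
    using norm_E_2_mult[of "exp \<zeta>" \<alpha> \<beta>] by simp
  also have "\<dots> \<le> ?W powr \<alpha> / (\<kappa> * (1 + ?W\<^sup>2)) powr ?p"
    using pos le assms(3) by (intro divide_left_mono powr_mono2 mult_pos_pos) auto
  also have "\<dots> = 1 / \<kappa> powr ?p * (?W powr \<alpha> / (1 + ?W\<^sup>2) powr ?p)"
    using assms(2) by (simp add: powr_mult)
  also have "\<dots> \<le> 1 / \<kappa> powr ?p * exp_decay \<alpha> \<beta> (Re \<zeta>)"
    using assms by (intro mult_left_mono powr_one_plus_square_le_exp_decay) auto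
  finally show ?thesis .
qed

subsection \<open>Hyperbolic functions\<close>

lemma sinh_le_mult_cosh:
  assumes "0 \<le> (u::real)"
  shows "sinh u \<le> u * cosh u"
proof -
  have "0 * cosh 0 - sinh 0 \<le> u * cosh u - sinh u"
  proof (rule DERIV_nonneg_imp_nondecreasing[OF assms, of "\<lambda>u. u * cosh u - sinh u"])
    fix x :: real assume "0 \<le> x"
    moreover have "((\<lambda>u. u * cosh u - sinh u) has_real_derivative x * sinh x) (at x)"
      by (auto intro!: derivative_eq_intros)
    ultimately show "\<exists>y. ((\<lambda>u. u * cosh u - sinh u) has_real_derivative y) (at x) \<and> 0 \<le> y" by auto
  qed
  thus ?thesis by simp
qed

lemma le_sinh: "0 \<le> u \<Longrightarrow> u \<le> sinh u" for u :: real
  using real_le_x_sinh[of u] by (simp add: sinh_field_def exp_minus)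

lemma Re_sinh: "Re (sinh z) = sinh (Re z) * cos (Im z)"
  and norm_sinh_squared: "(norm (sinh z))\<^sup>2 = (sinh (Re z))\<^sup>2 + (sin (Im z))\<^sup>2"
  and norm_cosh_squared: "(norm (cosh z))\<^sup>2 = (sinh (Re z))\<^sup>2 + (cos (Im z))\<^sup>2"
proof -
  have sinh_parts: "Re (sinh z) = sinh (Re z) * cos (Im z)" "Im (sinh z) = cosh (Re z) * sin (Im z)"
    and cosh_parts: "Re (cosh z) = cosh (Re z) * cos (Im z)" "Im (cosh z) = sinh (Re z) * sin (Im z)"
    by (auto simp: sinh_field_def cosh_field_def Re_exp Im_exp field_simps)
  have squares: "(cosh (Re z))\<^sup>2 = (sinh (Re z))\<^sup>2 + 1" "(sin (Im z))\<^sup>2 = 1 - (cos (Im z))\<^sup>2"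
    by (simp_all add: cosh_square_eq sin_squared_eq)
  show "(norm (sinh z))\<^sup>2 = (sinh (Re z))\<^sup>2 + (sin (Im z))\<^sup>2"
    unfolding cmod_power2 sinh_parts power_mult_distrib squares by (simp add: algebra_simps)
  show "(norm (cosh z))\<^sup>2 = (sinh (Re z))\<^sup>2 + (cos (Im z))\<^sup>2"
    unfolding cmod_power2 cosh_parts power_mult_distrib squares by (simp add: algebra_simps)
  show "Re (sinh z) = sinh (Re z) * cos (Im z)" by (rule sinh_parts)
qed

lemma cosh_nonzero: "\<bar>Im z\<bar> < pi / 2 \<Longrightarrow> cosh z \<noteq> 0" for z :: complex
proof
  assume "\<bar>Im z\<bar> < pi / 2" "cosh z = 0"
  hence "0 < cos (Im z)" by (intro cos_gt_zero_pi) auto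
  hence "0 < (norm (cosh z))\<^sup>2" unfolding norm_cosh_squared by (intro add_nonneg_pos) auto
  thus False using \<open>cosh z = 0\<close> by simp
qed

lemma norm_cosh_le_exp:
  fixes z :: complex
  assumes "0 \<le> Re z"
  shows "norm (cosh z) \<le> exp (Re z)"
proof (rule power2_le_imp_le)
  have "(norm (cosh z))\<^sup>2 \<le> (cosh (Re z))\<^sup>2"
    unfolding norm_cosh_squared by (simp add: cosh_square_eq abs_square_le_1)
  also have "\<dots> \<le> (exp (Re z))\<^sup>2"
    using assms by (intro power_mono) (auto simp: cosh_field_def)
  finally show "(norm (cosh z))\<^sup>2 \<le> (exp (Re z))\<^sup>2" .
qed simp

lemma norm_tanh_squared: "(norm (tanh z))\<^sup>2 = (norm (sinh z))\<^sup>2 / (norm (cosh z))\<^sup>2" for z :: complex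
  by (simp add: tanh_def norm_divide power_divide)

lemma norm_one_plus_squared: "(norm (1 + z))\<^sup>2 = 1 + 2 * Re z + (Re z)\<^sup>2 + (Im z)\<^sup>2"
  unfolding cmod_power2 by (simp add: power2_eq_square algebra_simps)

lemma norm_ratio_le_norm_tanh:
  fixes z :: complex
  assumes "0 \<le> Re z" "\<bar>Im z\<bar> < pi / 2"
  shows "norm (z / (1 + z)) \<le> sqrt 2 * norm (tanh z)"
proof -
  define u v S s c where "u = Re z" "v = Im z"
    "S = (sinh (Re z))\<^sup>2" "s = (sin (Im z))\<^sup>2" "c = (cos (Im z))\<^sup>2"
  have "0 < cos v" using assms by (intro cos_gt_zero_pi) (auto simp: u_v_S_s_c_def)
  hence "\<bar>v\<bar> * cos v \<le> \<bar>sin v\<bar>"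
    using abs_tan_ge[of v] assms by (simp add: u_v_S_s_c_def tan_def abs_divide field_simps)
  hence v_le: "v\<^sup>2 * c \<le> s"
    using \<open>0 < cos v\<close> power_mono[of "\<bar>v\<bar> * cos v" "\<bar>sin v\<bar>" 2]
    by (simp add: power_mult_distrib u_v_S_s_c_def)
  have u_le: "u\<^sup>2 \<le> S" using le_sinh[of u] assms by (auto simp: u_v_S_s_c_def intro!: power_mono)
  have nonneg: "0 \<le> u" "0 \<le> S" "0 \<le> s" "0 \<le> c" and "c \<le> 1"
    using assms by (auto simp: u_v_S_s_c_def abs_square_le_1)
  let ?q = "1 + 2 * u + u\<^sup>2 + v\<^sup>2"
  have "1 \<le> ?q" using nonneg by simp
  have "(u\<^sup>2 + v\<^sup>2) * (S + c) = (u\<^sup>2 + v\<^sup>2) * S + u\<^sup>2 * c + v\<^sup>2 * c" by (simp add: algebra_simps)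
  also have "(u\<^sup>2 + v\<^sup>2) * S \<le> ?q * S" using nonneg by (intro mult_right_mono) auto
  also have "u\<^sup>2 * c \<le> S * ?q"
    using u_le nonneg order_trans[OF \<open>c \<le> 1\<close> \<open>1 \<le> ?q\<close>] by (intro mult_mono) auto
  also have "v\<^sup>2 * c \<le> 2 * (s * ?q)"
    using v_le nonneg mult_left_mono[OF \<open>1 \<le> ?q\<close> nonneg(3)] by linarith
  finally have "(norm z)\<^sup>2 * (norm (cosh z))\<^sup>2 \<le> 2 * ((norm (sinh z))\<^sup>2 * (norm (1 + z))\<^sup>2)"
    unfolding norm_sinh_squared norm_cosh_squared norm_one_plus_squared cmod_power2[of z]
    by (simp add: u_v_S_s_c_def algebra_simps)
  moreover have "1 + z \<noteq> 0" using assms(1) by (auto simp: complex_eq_iff)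
  ultimately have "(norm (z / (1 + z)))\<^sup>2 \<le> (sqrt 2 * norm (tanh z))\<^sup>2"
    using cosh_nonzero[OF assms(2)]
    by (simp add: norm_tanh_squared power_mult_distrib norm_divide power_divide field_simps)
  thus ?thesis by (rule power2_le_imp_le) simp
qed

text \<open>
  The plain estimate \<open>|tanh z| \<le> |z|\<close> fails near the imaginary axis. There the sector condition
  \<open>\<kappa> |sinh z| \<le> Re (sinh z) = sinh u cos v\<close> compensates, through
  \<open>|sin v| \<le> |sinh z| \<le> sinh u cos v / \<kappa> \<le> |cosh z|\<^sup>2 / (2\<kappa>)\<close> for \<open>z = u + iv\<close>.
\<close>

lemma norm_tanh_squared_le:
  fixes z :: complex
  assumes "0 \<le> Re z" "\<bar>Im z\<bar> < pi / 2" "0 < \<kappa>" "sinh z \<in> sector \<kappa>"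
  shows "(norm (tanh z))\<^sup>2 \<le> (norm z)\<^sup>2 + (Im z)\<^sup>2 / (2 * \<kappa>)"
proof -
  define u v S where "u = Re z" and "v = Im z" and "S = (norm (cosh z))\<^sup>2"
  have S: "S = (sinh u)\<^sup>2 + (cos v)\<^sup>2" by (simp add: S_def u_def v_def norm_cosh_squared)
  have u_le: "u\<^sup>2 \<le> (sinh u)\<^sup>2" using le_sinh[of u] assms(1)
    by (auto simp: u_def intro!: power_mono)
  have "\<bar>sin v\<bar> \<le> norm (sinh z)"
    by (rule power2_le_imp_le) (simp_all add: norm_sinh_squared v_def)
  also have "\<dots> \<le> sinh u * cos v / \<kappa>"
    using assms by (simp add: sector_def Re_sinh u_def v_def field_simps)
  also have "\<dots> \<le> S / 2 / \<kappa>"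
    using assms(3) sum_squares_bound[of "sinh u" "cos v"]
    by (intro divide_right_mono) (auto simp: S)
  finally have "\<bar>sin v\<bar> \<le> S / (2 * \<kappa>)" by simp
  moreover have "(sin v)\<^sup>2 \<le> \<bar>sin v\<bar>"
    using mult_right_le_one_le[of "\<bar>sin v\<bar>" "\<bar>sin v\<bar>"]
    by (simp add: power2_eq_square abs_mult[symmetric])
  ultimately have "1 + u\<^sup>2 \<le> S + S / (2 * \<kappa>)"
    using u_le S sin_cos_squared_add[of v] by linarith
  moreover have "(sin v)\<^sup>2 \<le> v\<^sup>2" using abs_sin_x_le_abs_x[of v] by (simp add: abs_le_square_iff)
  ultimately have "(1 + u\<^sup>2) * (sin v)\<^sup>2 \<le> (S + S / (2 * \<kappa>)) * v\<^sup>2"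
    using assms(3) by (intro mult_mono) (auto simp: S_def)
  moreover have "(sinh u)\<^sup>2 \<le> u\<^sup>2 * (S + (sin v)\<^sup>2)"
  proof -
    have "(sinh u)\<^sup>2 \<le> (u * cosh u)\<^sup>2"
      using sinh_le_mult_cosh[of u] assms(1) by (auto simp: u_def intro!: power_mono)
    thus ?thesis by (simp add: power_mult_distrib cosh_square_eq S add.assoc)
  qed
  ultimately have "(norm (sinh z))\<^sup>2 \<le> (u\<^sup>2 + v\<^sup>2 + v\<^sup>2 / (2 * \<kappa>)) * S"
    by (simp add: norm_sinh_squared u_def[symmetric] v_def[symmetric] algebra_simps)
  thus ?thesis
    using cosh_nonzero[OF assms(2)]
    by (simp add: norm_tanh_squared S_def u_def v_def cmod_power2[of z] divide_le_eq)
qed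

lemma norm_tanh_le_norm_ratio:
  fixes z :: complex
  assumes z: "0 \<le> Re z" "\<bar>Im z\<bar> < pi / 2" and \<kappa>: "0 < \<kappa>" "sinh z \<in> sector \<kappa>"
  shows "norm (tanh z) \<le> sqrt (2 * (1 + 1 / \<kappa>)) * norm (z / (1 + z))"
proof -
  define u v T where "u = Re z" and "v = Im z" and "T = (norm (tanh z))\<^sup>2"
  have norm_z: "(norm z)\<^sup>2 = u\<^sup>2 + v\<^sup>2" by (simp add: cmod_power2 u_def v_def)
  have T_le: "T \<le> u\<^sup>2 + v\<^sup>2 + v\<^sup>2 / (2 * \<kappa>)"
    using norm_tanh_squared_le[OF z \<kappa>] by (simp only: T_def norm_z v_def)
  define a where "a = 2 * (1 + 1 / \<kappa>)"
  have "0 \<le> a" using \<kappa>(1) by (simp add: a_def)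
  have "1 + (sinh z)\<^sup>2 = (cosh z)\<^sup>2" by (simp add: cosh_square_eq)
  hence "\<kappa> * (norm (sinh z))\<^sup>2 \<le> (norm (cosh z))\<^sup>2"
    using norm_one_plus_square_ge[OF \<kappa>(2)] \<kappa>(1) by (simp add: norm_power distrib_left)
  hence "T \<le> 1 / \<kappa>"
    using \<kappa>(1) cosh_nonzero[OF z(2)] by (simp add: T_def norm_tanh_squared field_simps)
  have "T * (1 + 2 * u + u\<^sup>2 + v\<^sup>2) \<le> T * (2 + (2 * u\<^sup>2 + v\<^sup>2))"
    using sum_squares_bound[of u 1] by (intro mult_left_mono) (auto simp: T_def)
  also have "\<dots> = 2 * T + T * (2 * u\<^sup>2 + v\<^sup>2)" by (simp add: algebra_simps)
  also have "\<dots> \<le> 2 * (u\<^sup>2 + v\<^sup>2 + v\<^sup>2 / (2 * \<kappa>)) + 1 / \<kappa> * (2 * u\<^sup>2 + v\<^sup>2)"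
    using T_le \<open>T \<le> 1 / \<kappa>\<close> by (intro add_mono mult_left_mono mult_right_mono) auto
  also have "\<dots> = a * (norm z)\<^sup>2" using \<kappa> by (simp add: a_def norm_z field_simps)
  finally have "T * (norm (1 + z))\<^sup>2 \<le> a * (norm z)\<^sup>2"
    by (simp add: norm_one_plus_squared u_def v_def)
  moreover have "1 + z \<noteq> 0" using z(1) by (auto simp: complex_eq_iff)
  ultimately have "T \<le> (sqrt a * norm (z / (1 + z)))\<^sup>2"
    using \<open>0 \<le> a\<close> by (simp add: power_mult_distrib norm_divide power_divide pos_le_divide_eq)
  hence "norm (tanh z) \<le> sqrt a * norm (z / (1 + z))"
    unfolding T_def by (rule power2_le_imp_le) (use \<open>0 \<le> a\<close> in simp)
  thus ?thesis by (simp only: a_def)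
qed

lemma ratio_le_tanh_real:
  assumes "0 \<le> (t::real)"
  shows "t / (1 + t) \<le> tanh t"
proof -
  have "t * exp (- t) \<le> t * 1" using assms by (intro mult_left_mono) auto
  also have "\<dots> \<le> sinh t" using le_sinh[OF assms] by simp
  finally have "t * (cosh t - sinh t) \<le> sinh t" by (simp add: cosh_minus_sinh)
  thus ?thesis using assms by (simp add: tanh_def field_simps)
qed

lemma tanh_le_ratio_real:
  assumes "0 \<le> (t::real)"
  shows "tanh t \<le> 2 * (t / (1 + t))"
proof (cases "t \<le> 1")
  case True
  have "tanh t \<le> t" using sinh_le_mult_cosh[OF assms] by (simp add: tanh_def field_simps)
  also have "t \<le> 2 * (t / (1 + t))" using True assms by (simp add: field_simps mult_left_le)
  finally show ?thesis .
next
  case False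
  hence "1 \<le> 2 * (t / (1 + t))" by (simp add: field_simps)
  thus ?thesis using tanh_real_lt_1[of t] by linarith
qed

subsection \<open>The inverse hyperbolic sine in the complex plane\<close>

lemma
  fixes w :: complex
  shows exp_arsinh_complex: "exp (arsinh w) = w + csqrt (w\<^sup>2 + 1)"
    and exp_minus_arsinh_complex: "exp (- arsinh w) = csqrt (w\<^sup>2 + 1) - w"
proof -
  define s where "s = csqrt (w\<^sup>2 + 1)"
  have "(w + s) * (s - w) = s\<^sup>2 - w\<^sup>2" by (simp add: algebra_simps power2_eq_square)
  hence "(w + s) * (s - w) = 1" by (simp add: s_def)
  hence "w + s \<noteq> 0" "inverse (w + s) = s - w" by (auto simp: inverse_unique)
  moreover have "arsinh w = ln (w + s)" by (simp add: arsinh_def s_def csqrt_conv_powr)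
  ultimately show "exp (arsinh w) = w + csqrt (w\<^sup>2 + 1)" "exp (- arsinh w) = csqrt (w\<^sup>2 + 1) - w"
    by (simp_all add: exp_minus s_def)
qed

lemma sinh_arsinh_complex: "sinh (arsinh w) = w"
  and cosh_arsinh_complex: "cosh (arsinh w) = csqrt (w\<^sup>2 + 1)" for w :: complex
  by (simp_all add: sinh_field_def cosh_field_def exp_arsinh_complex exp_minus_arsinh_complex)

lemma arsinh_complex_right_half_plane:
  fixes w :: complex
  assumes "0 < Re w"
  shows "\<bar>Im (arsinh w)\<bar> < pi / 2" "0 < Re (arsinh w)"
proof -
  have "0 < Re (w + csqrt (w\<^sup>2 + 1))"
    using assms csqrt_principal[of "w\<^sup>2 + 1"] by (auto simp del: csqrt.sel)
  moreover have "arsinh w = ln (w + csqrt (w\<^sup>2 + 1))" by (simp add: arsinh_def csqrt_conv_powr)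
  ultimately show im: "\<bar>Im (arsinh w)\<bar> < pi / 2" by (simp only: Re_Ln_pos_lt_imp)
  have "0 < sinh (Re (arsinh w)) * cos (Im (arsinh w))"
    using assms Re_sinh[of "arsinh w"] by (simp add: sinh_arsinh_complex)
  moreover have "0 < cos (Im (arsinh w))" using im by (intro cos_gt_zero_pi) auto
  ultimately show "0 < Re (arsinh w)" by (simp add: zero_less_mult_iff)
qed

lemma exp_arsinh_notin_nonpos_Reals: "exp (arsinh w) \<notin> \<real>\<^sub>\<le>\<^sub>0" for w :: complex
proof
  assume "exp (arsinh w) \<in> \<real>\<^sub>\<le>\<^sub>0"
  then obtain x where x: "exp (arsinh w) = of_real x" "x \<le> 0" by (auto elim: nonpos_Reals_cases)
  hence "x < 0" by (cases "x = 0") auto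
  have "exp (arsinh w) + exp (- arsinh w) = 2 * csqrt (w\<^sup>2 + 1)"
    by (simp add: exp_arsinh_complex exp_minus_arsinh_complex)
  hence "of_real (x + 1 / x) = 2 * csqrt (w\<^sup>2 + 1)" by (simp add: exp_minus x divide_inverse)
  from arg_cong[OF this, of Re] have "x + 1 / x = 2 * Re (csqrt (w\<^sup>2 + 1))"
    by (simp del: csqrt.sel of_real_add of_real_divide)
  moreover have "x + 1 / x < 0" using \<open>x < 0\<close> by (intro add_neg_neg) auto
  ultimately show False using csqrt_principal[of "w\<^sup>2 + 1"] by (auto simp del: csqrt.sel)
qed

lemma has_field_derivative_arsinh_complex:
  fixes w :: complex
  assumes "w\<^sup>2 + 1 \<notin> \<real>\<^sub>\<le>\<^sub>0"
  shows "(arsinh has_field_derivative 1 / cosh (arsinh w)) (at w)"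
proof -
  define s where "s = csqrt (w\<^sup>2 + 1)"
  have "w + s \<notin> \<real>\<^sub>\<le>\<^sub>0"
    using exp_arsinh_notin_nonpos_Reals[of w] by (simp add: exp_arsinh_complex s_def)
  hence "((\<lambda>w. ln (w + csqrt (w\<^sup>2 + 1))) has_field_derivative (1 + 2 * w / (2 * s)) / (w + s)) (at w)"
    using assms unfolding s_def by (auto intro!: derivative_eq_intros simp: field_simps)
  also have "(\<lambda>w. ln (w + csqrt (w\<^sup>2 + 1))) = arsinh"
    by (auto simp: arsinh_def csqrt_conv_powr)
  also have "(1 + 2 * w / (2 * s)) / (w + s) = 1 / cosh (arsinh w)"
  proof -
    have "s \<noteq> 0" "w + s \<noteq> 0"
      using assms \<open>w + s \<notin> \<real>\<^sub>\<le>\<^sub>0\<close> by (auto simp: s_def)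
    moreover from this have "1 + 2 * w / (2 * s) = (w + s) / s" by (simp add: field_simps)
    ultimately show ?thesis by (simp add: cosh_arsinh_complex s_def)
  qed
  finally show ?thesis .
qed

lemma square_plus_one_notin_nonpos_Reals:
  assumes "0 < Re w"
  shows "w\<^sup>2 + 1 \<notin> \<real>\<^sub>\<le>\<^sub>0"
proof
  assume "w\<^sup>2 + 1 \<in> \<real>\<^sub>\<le>\<^sub>0"
  hence "(Re w)\<^sup>2 - (Im w)\<^sup>2 + 1 \<le> 0" "Im w = 0"
    using assms by (auto simp: complex_nonpos_Reals_iff power2_eq_square)
  thus False using zero_le_power2[of "Re w"] by auto
qed

lemma arsinh_of_real:
  "arsinh (complex_of_real x) = of_real (arsinh x)"
proof -
  have "csqrt (of_real (x\<^sup>2 + 1)) = of_real (sqrt (x\<^sup>2 + 1))"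
    by (subst csqrt_of_real_nonneg) simp_all
  thus ?thesis
    using arsinh_real_aux[of x]
    by (simp add: arsinh_def powr_half_sqrt Ln_of_real flip: csqrt_conv_powr of_real_add)
qed

subsection \<open>The weight for the inverse hyperbolic sine map\<close>

lemma sinh_nonzero: "0 < Re z \<Longrightarrow> sinh z \<noteq> 0" for z :: complex
proof
  assume "0 < Re z" "sinh z = 0"
  hence "0 < (sinh (Re z))\<^sup>2" by simp
  hence "0 < (norm (sinh z))\<^sup>2" unfolding norm_sinh_squared by (intro add_pos_nonneg) auto
  thus False using \<open>sinh z = 0\<close> by simp
qed

lemma tanh_powr_mult_exp_le_E_2:
  fixes z :: complex
  assumes z: "0 < Re z" "\<bar>Im z\<bar> < pi / 2" and "0 \<le> \<beta>"
  shows "norm (tanh z) powr \<alpha> * exp (- \<beta> * Re z) \<le> norm (E 2 (sinh z) \<alpha> \<beta>) * norm (sinh z)"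
proof -
  let ?c = "norm (cosh z)"
  have "0 < ?c" using cosh_nonzero[OF z(2)] by simp
  have "norm (tanh z) powr \<alpha> = norm (sinh z) powr \<alpha> / ?c powr \<alpha>"
    by (simp add: tanh_def norm_divide powr_divide)
  moreover have "exp (- \<beta> * Re z) \<le> 1 / ?c powr \<beta>"
  proof -
    have "exp (- \<beta> * Re z) = 1 / exp (Re z) powr \<beta>" by (simp add: powr_def exp_minus divide_inverse)
    also have "\<dots> \<le> 1 / ?c powr \<beta>"
      using \<open>0 < ?c\<close> norm_cosh_le_exp[of z] z(1) \<open>0 \<le> \<beta>\<close> by (intro divide_left_mono powr_mono2) auto
    finally show ?thesis .
  qed
  ultimately have "norm (tanh z) powr \<alpha> * exp (- \<beta> * Re z)
      \<le> norm (sinh z) powr \<alpha> / ?c powr \<alpha> * (1 / ?c powr \<beta>)"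
    by (intro mult_mono) auto
  also have "\<dots> = norm (sinh z) powr \<alpha> / ?c powr (\<alpha> + \<beta>)" by (simp add: powr_add)
  also have "?c powr (\<alpha> + \<beta>) = (?c\<^sup>2) powr ((\<alpha> + \<beta>) / 2)"
  proof -
    have "?c powr (2 * p) = (?c\<^sup>2) powr p" for p
      using \<open>0 < ?c\<close> by (simp add: powr_powr flip: powr_numeral)
    from this[of "(\<alpha> + \<beta>) / 2"] show ?thesis by (simp only: mult_2 field_sum_of_halves)
  qed
  also have "?c\<^sup>2 = norm (1 + (sinh z)\<^sup>2)"
    by (simp add: cosh_square_eq add.commute flip: norm_power)
  also have "norm (sinh z) powr \<alpha> / norm (1 + (sinh z)\<^sup>2) powr ((\<alpha> + \<beta>) / 2) =
      norm (E 2 (sinh z) \<alpha> \<beta>) * norm (sinh z)"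
    using sinh_nonzero[OF z(1)] by (rule norm_E_2_mult[symmetric])
  finally show ?thesis .
qed

lemma E_3_mult_tanh_le_E_2:
  fixes z :: complex
  assumes z: "0 < Re z" "\<bar>Im z\<bar> < pi / 2" and "0 \<le> \<beta>" "0 \<le> C"
    and ratio: "norm (z / (1 + z)) powr (\<alpha> - 1) \<le> C * norm (tanh z) powr (\<alpha> - 1)"
  shows "norm (E 3 z \<alpha> \<beta>) * norm (tanh z) \<le> C * (norm (E 2 (sinh z) \<alpha> \<beta>) * norm (sinh z))"
proof -
  let ?T = "norm (tanh z)"
  have "0 < ?T" using sinh_nonzero[OF z(1)] cosh_nonzero[OF z(2)] by (simp add: tanh_def)
  have "norm (E 3 z \<alpha> \<beta>) = norm (z / (1 + z)) powr (\<alpha> - 1) * exp (- \<beta> * Re z)"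
    by (simp add: E_def norm_mult norm_powr_of_real del: of_real_diff)
  hence "norm (E 3 z \<alpha> \<beta>) * ?T \<le> C * ?T powr (\<alpha> - 1) * exp (- \<beta> * Re z) * ?T"
    by (simp only:) (intro mult_right_mono ratio; simp)
  also have "\<dots> = C * (?T powr \<alpha> * exp (- \<beta> * Re z))" using \<open>0 < ?T\<close> by (simp add: powr_diff)
  also have "\<dots> \<le> C * (norm (E 2 (sinh z) \<alpha> \<beta>) * norm (sinh z))"
    using assms(4) by (intro mult_left_mono tanh_powr_mult_exp_le_E_2[OF z assms(3)])
  finally show ?thesis .
qed

lemma powr_le_mult_powr:
  fixes x y a b :: real
  assumes "0 \<le> b" "0 \<le> x" "x \<le> a * y"
  shows "x powr b \<le> a powr b * y powr b"
  using powr_mono2[OF assms] by (simp add: powr_mult)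

lemma powr_le_mult_powr_nonpos:
  fixes x y a b :: real
  assumes "b \<le> 0" "0 < y" "0 < a" "y \<le> a * x"
  shows "x powr b \<le> a powr (- b) * y powr b"
proof -
  have "(a * x) powr b \<le> y powr b" using assms by (intro powr_mono2') auto
  hence "a powr (- b) * (a powr b * x powr b) \<le> a powr (- b) * y powr b"
    by (intro mult_left_mono) (simp_all add: powr_mult)
  moreover have "a powr (- b) * a powr b = 1" using assms(3) by (simp flip: powr_add)
  ultimately show ?thesis by (simp flip: mult.assoc)
qed

lemma c_ad_nonneg: "0 \<le> c_ad \<alpha> d"
  by (simp add: c_ad_def)

lemma ratio_powr_le_c_ad:
  fixes z :: complex
  assumes z: "0 < Re z" "\<bar>Im z\<bar> < pi / 2" and d: "0 < cos d" "sinh z \<in> sector (cos d)"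
  shows "norm (z / (1 + z)) powr (\<alpha> - 1) \<le> c_ad \<alpha> d * norm (tanh z) powr (\<alpha> - 1)"
proof (cases "\<alpha> < 1")
  case True
  have "0 < 2 * (1 + 1 / cos d)" using d(1) by (simp add: add_pos_pos)
  moreover have "tanh z \<noteq> 0"
    using d(2) cosh_nonzero[OF z(2)] by (simp add: tanh_def sector_def)
  moreover have "norm (tanh z) \<le> sqrt (2 * (1 + 1 / cos d)) * norm (z / (1 + z))"
    using z d by (intro norm_tanh_le_norm_ratio) auto
  ultimately have "norm (z / (1 + z)) powr (\<alpha> - 1)
      \<le> sqrt (2 * (1 + 1 / cos d)) powr (- (\<alpha> - 1)) * norm (tanh z) powr (\<alpha> - 1)"
    using True by (intro powr_le_mult_powr_nonpos) auto
  also have "sqrt (2 * (1 + 1 / cos d)) powr (- (\<alpha> - 1)) = c_ad \<alpha> d"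
    using True \<open>0 < 2 * (1 + 1 / cos d)\<close> by (simp add: c_ad_def powr_half_sqrt[symmetric] powr_powr)
  finally show ?thesis .
next
  case False
  hence "norm (z / (1 + z)) powr (\<alpha> - 1) \<le> sqrt 2 powr (\<alpha> - 1) * norm (tanh z) powr (\<alpha> - 1)"
    using z by (intro powr_le_mult_powr norm_ratio_le_norm_tanh) auto
  also have "sqrt 2 powr (\<alpha> - 1) = c_ad \<alpha> d"
    using False by (simp add: c_ad_def powr_half_sqrt[symmetric] powr_powr)
  finally show ?thesis .
qed

lemma ratio_powr_le_real:
  fixes t :: real
  assumes "0 < t"
  shows "(t / (1 + t)) powr (\<alpha> - 1) \<le> 2 powr ((1 - \<alpha> + \<bar>1 - \<alpha>\<bar>) / 2) * tanh t powr (\<alpha> - 1)"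
proof (cases "\<alpha> < 1")
  case True
  hence "(t / (1 + t)) powr (\<alpha> - 1) \<le> 2 powr (- (\<alpha> - 1)) * tanh t powr (\<alpha> - 1)"
    using assms by (intro powr_le_mult_powr_nonpos tanh_le_ratio_real) auto
  moreover have "- (\<alpha> - 1) = (1 - \<alpha> + \<bar>1 - \<alpha>\<bar>) / 2" using True by simp
  ultimately show ?thesis by (simp only:)
next
  case False
  hence "(t / (1 + t)) powr (\<alpha> - 1) \<le> 1 powr (\<alpha> - 1) * tanh t powr (\<alpha> - 1)"
    using assms ratio_le_tanh_real[of t] by (intro powr_le_mult_powr) auto
  thus ?thesis using False by simp
qed

lemma E_3_le_exp_decay:
  assumes w: "exp \<zeta> \<in> sector (cos d)" and "0 < cos d" "0 < \<alpha>" "0 < \<beta>"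
  shows "norm (E 3 (arsinh (exp \<zeta>)) \<alpha> \<beta>) * norm (tanh (arsinh (exp \<zeta>)))
    \<le> c_ad \<alpha> d / cos d powr ((\<alpha> + \<beta>) / 2) * exp_decay \<alpha> \<beta> (Re \<zeta>)"
proof -
  have "0 < Re (exp \<zeta>)" using sector_Re_pos[OF assms(2) w] .
  note z = arsinh_complex_right_half_plane(2,1)[OF this]
  have "norm (E 3 (arsinh (exp \<zeta>)) \<alpha> \<beta>) * norm (tanh (arsinh (exp \<zeta>)))
      \<le> c_ad \<alpha> d * (norm (E 2 (exp \<zeta>) \<alpha> \<beta>) * norm (exp \<zeta>))"
    using E_3_mult_tanh_le_E_2[OF z _ c_ad_nonneg ratio_powr_le_c_ad[OF z assms(2)]] w assms(4)
    by (simp add: sinh_arsinh_complex)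
  also have "\<dots> \<le> c_ad \<alpha> d * (1 / cos d powr ((\<alpha> + \<beta>) / 2) * exp_decay \<alpha> \<beta> (Re \<zeta>))"
    using assms by (intro mult_left_mono E_2_le_exp_decay[OF w] c_ad_nonneg) auto
  finally show ?thesis by simp
qed

lemma E_3_le_exp_decay_real:
  fixes x :: real
  assumes "0 < \<alpha>" "0 < \<beta>"
  shows "norm (E 3 (arsinh (exp (of_real x))) \<alpha> \<beta>) * norm (tanh (arsinh (exp (complex_of_real x))))
    \<le> 2 powr ((1 - \<alpha> + \<bar>1 - \<alpha>\<bar>) / 2) * exp_decay \<alpha> \<beta> x"
proof -
  let ?C = "2 powr ((1 - \<alpha> + \<bar>1 - \<alpha>\<bar>) / 2)"
  define t where "t = arsinh (exp x)"
  have "0 < t" by (simp add: t_def)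
  have z: "arsinh (exp (complex_of_real x)) = of_real t"
    by (simp add: t_def arsinh_of_real exp_of_real)
  have "tanh (complex_of_real t) = of_real (tanh t)"
    by (simp add: tanh_altdef exp_of_real flip: of_real_minus)
  moreover have "complex_of_real t / (1 + of_real t) = of_real (t / (1 + t))" by simp
  ultimately have "norm (complex_of_real t / (1 + of_real t)) powr (\<alpha> - 1)
      \<le> ?C * norm (tanh (complex_of_real t)) powr (\<alpha> - 1)"
    using ratio_powr_le_real[OF \<open>0 < t\<close>, of \<alpha>] \<open>0 < t\<close> by (simp only: norm_of_real) simp
  hence "norm (E 3 (of_real t) \<alpha> \<beta>) * norm (tanh (complex_of_real t))
      \<le> ?C * (norm (E 2 (sinh (of_real t)) \<alpha> \<beta>) * norm (sinh (complex_of_real t)))"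
    using \<open>0 < t\<close> assms by (intro E_3_mult_tanh_le_E_2) auto
  also have "sinh (complex_of_real t) = exp (of_real x)" by (simp flip: z add: sinh_arsinh_complex)
  also have "?C * (norm (E 2 (exp (of_real x)) \<alpha> \<beta>) * norm (exp (complex_of_real x)))
      \<le> ?C * exp_decay \<alpha> \<beta> x"
    using E_2_le_exp_decay[OF exp_of_real_in_sector, of \<alpha> \<beta> x] assms by (intro mult_left_mono) auto
  finally show ?thesis by (simp only: z)
qed

subsection \<open>The two transformations\<close>

lemma psi_2: "psi 2 = exp" and psi_3: "psi 3 = (\<lambda>z. arsinh (exp z))"
  by (auto simp: psi_def)

lemma deriv_psi_2: "deriv (psi 2) \<zeta> = exp \<zeta>"
  by (simp add: psi_2 DERIV_imp_deriv)

lemma has_field_derivative_psi_3: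
  assumes "\<zeta> \<in> strip d" "0 < d" "d < pi / 2"
  shows "(psi 3 has_field_derivative tanh (psi 3 \<zeta>)) (at \<zeta>)"
proof -
  have "0 < Re (exp \<zeta>)"
    using sector_Re_pos[OF cos_gt_zero exp_strip_in_sector] assms by simp
  note has_field_derivative_arsinh_complex[OF square_plus_one_notin_nonpos_Reals[OF this]]
  from DERIV_chain2[OF this DERIV_exp] show ?thesis
    by (simp add: psi_3 tanh_def sinh_arsinh_complex)
qed

lemmas deriv_psi_3 = has_field_derivative_psi_3[THEN DERIV_imp_deriv]

lemma halfline_map_psi_2: "halfline_map d (psi 2)"
  unfolding halfline_map_def
proof (intro conjI exI)
  show "psi 2 analytic_on strip d" unfolding psi_2 by (intro analytic_intros)
  show "strict_mono (exp :: real \<Rightarrow> real)" by (simp add: strict_mono_def)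
  show "range exp = {0::real<..}" by (auto simp: image_iff intro: exp_ln[symmetric])
  show "\<forall>x. psi 2 (of_real x) = of_real (exp x)" by (simp add: psi_2 exp_of_real)
qed

lemma halfline_map_psi_3:
  assumes "0 < d" "d < pi / 2"
  shows "halfline_map d (psi 3)"
  unfolding halfline_map_def
proof (intro conjI exI)
  show "psi 3 analytic_on strip d"
    using has_field_derivative_psi_3[OF _ assms]
    by (auto simp: analytic_on_open open_strip holomorphic_on_open)
  show "strict_mono (\<lambda>x. arsinh (exp x) :: real)" by (simp add: strict_mono_def)
  show "range (\<lambda>x. arsinh (exp x)) = {0::real<..}"
  proof
    show "{0<..} \<subseteq> range (\<lambda>x. arsinh (exp x) :: real)"
    proof
      fix t :: real assume "t \<in> {0<..}"
      hence "arsinh (exp (ln (sinh t))) = t" by (simp add: arsinh_sinh_real)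
      thus "t \<in> range (\<lambda>x. arsinh (exp x))" by (metis rangeI)
    qed
  qed auto
  show "\<forall>x. psi 3 (of_real x) = of_real (arsinh (exp x))"
    by (simp add: psi_3 exp_of_real arsinh_of_real)
qed

lemma E_psi_2_le_exp_decay:
  assumes "\<zeta> \<in> strip d" "0 < d" "d < pi / 2" "0 < \<alpha>" "0 < \<beta>"
  shows "norm (E 2 (psi 2 \<zeta>) \<alpha> \<beta>) * norm (deriv (psi 2) \<zeta>)
    \<le> 1 / cos d powr ((\<alpha> + \<beta>) / 2) * exp_decay \<alpha> \<beta> (Re \<zeta>)"
  using E_2_le_exp_decay[OF exp_strip_in_sector cos_gt_zero] assms
  unfolding deriv_psi_2 by (simp add: psi_2)

lemma E_psi_2_le_exp_decay_real:
  assumes "0 < \<alpha>" "0 < \<beta>"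
  shows "norm (E 2 (psi 2 (of_real x)) \<alpha> \<beta>) * norm (deriv (psi 2) (of_real x)) \<le> 1 * exp_decay \<alpha> \<beta> x"
  using E_2_le_exp_decay[OF exp_of_real_in_sector[of x], of \<alpha> \<beta>] assms
  unfolding deriv_psi_2 by (simp add: psi_2)

lemma E_psi_3_le_exp_decay:
  assumes \<zeta>: "\<zeta> \<in> strip d" and d: "0 < d" "d < pi / 2" and pos: "0 < \<alpha>" "0 < \<beta>"
  shows "norm (E 3 (psi 3 \<zeta>) \<alpha> \<beta>) * norm (deriv (psi 3) \<zeta>)
    \<le> c_ad \<alpha> d / cos d powr ((\<alpha> + \<beta>) / 2) * exp_decay \<alpha> \<beta> (Re \<zeta>)"
  using E_3_le_exp_decay[OF exp_strip_in_sector[OF \<zeta>] cos_gt_zero[OF d] pos] d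
  unfolding deriv_psi_3[OF \<zeta> d] by (simp add: psi_3)

lemma E_psi_3_le_exp_decay_real:
  assumes "0 < \<alpha>" "0 < \<beta>"
  shows "norm (E 3 (psi 3 (of_real x)) \<alpha> \<beta>) * norm (deriv (psi 3) (of_real x))
    \<le> 2 powr ((1 - \<alpha> + \<bar>1 - \<alpha>\<bar>) / 2) * exp_decay \<alpha> \<beta> x"
proof -
  have "of_real x \<in> strip (pi / 4)" by (rule of_real_in_strip) simp
  hence "deriv (psi 3) (of_real x) = tanh (psi 3 (of_real x))" by (rule deriv_psi_3) simp_all
  thus ?thesis using E_3_le_exp_decay_real[OF assms, of x] by (simp only: psi_3)
qed

lemma C_const_2_eq:
  "C_const 2 K \<alpha> \<beta> d = 2 * K / min \<alpha> \<beta> *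
    (2 * (1 / cos d powr ((\<alpha> + \<beta>) / 2)) / (1 - exp (- sqrt (2 * pi * d * min \<alpha> \<beta>))) + 1)"
  by (simp add: C_const_def Let_def mult.commute)

lemma C_const_3_ge:
  assumes "0 < d" "0 < K" "0 < \<alpha>" "0 < \<beta>"
  shows "2 * K / min \<alpha> \<beta> * (2 * (c_ad \<alpha> d / cos d powr ((\<alpha> + \<beta>) / 2))
        / (1 - exp (- sqrt (2 * pi * d * min \<alpha> \<beta>))) + 2 powr ((1 - \<alpha> + \<bar>1 - \<alpha>\<bar>) / 2))
    \<le> C_const 3 K \<alpha> \<beta> d"
proof -
  let ?c = "c_ad \<alpha> d / cos d powr ((\<alpha> + \<beta>) / 2)" and ?r = "1 - exp (- sqrt (2 * pi * d * min \<alpha> \<beta>))"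
  have "0 \<le> ?r" "0 \<le> ?c" using assms by (simp_all add: c_ad_nonneg)
  hence "2 * ?c / ?r \<le> 2 * (2 powr (\<beta> / 2) * ?c) / ?r"
    using assms(4) mult_right_mono[of 1 "2 powr (\<beta> / 2)" ?c]
    by (intro divide_right_mono mult_left_mono) (auto simp: ge_one_powr_ge_zero)
  moreover have "C_const 3 K \<alpha> \<beta> d = 2 * K / min \<alpha> \<beta> *
      (2 * (2 powr (\<beta> / 2) * ?c) / ?r + 2 powr ((1 - \<alpha> + \<bar>1 - \<alpha>\<bar>) / 2))"
    by (simp add: C_const_def Let_def powr_add mult_ac)
  ultimately show ?thesis
    using assms by (simp only:) (intro mult_left_mono add_right_mono, auto)
qed

theorem theorem4:
  fixes f :: "complex \<Rightarrow> complex" and d K \<alpha> \<beta> :: real and i n :: nat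
  assumes "0 < d" "d < pi / 2"
    and "i \<in> {2, 3}"
    and "f analytic_on (psi i ` strip d)"
    and "0 < K" "0 < \<alpha>" "0 < \<beta>"
    and "\<And>z. z \<in> psi i ` strip d \<Longrightarrow> norm (f z) \<le> K * norm (E i z \<alpha> \<beta>)"
    and "0 < n"
  shows "let \<mu> = min \<alpha> \<beta>;
             h = sqrt (2 * pi * d / (\<mu> * real n));
             M = (if \<mu> = \<alpha> then int n else \<lceil>\<beta> * real n / \<alpha>\<rceil>);
             N = (if \<mu> = \<alpha> then \<lceil>\<alpha> * real n / \<beta>\<rceil> else int n)
         in (\<lambda>t. f (of_real t)) integrable_on {0<..} \<and>
            norm (integral {0<..} (\<lambda>t. f (of_real t))
                  - of_real h * (\<Sum>k = -M..N. f (psi i (of_real (of_int k * h)))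
                                              * deriv (psi i) (of_real (of_int k * h))))
            \<le> C_const i K \<alpha> \<beta> d * exp (- sqrt (2 * pi * d * \<mu> * real n))"
proof -
  note error = halfline_quadrature_error[OF _ assms(4,1,6,7,9) less_imp_le[OF assms(5)] _ _ assms(8),
      unfolded trapezoidal_sum_def balanced_step_def left_cutoff_def right_cutoff_def]
  consider (exp) "i = 2" | (arsinh_exp) "i = 3" using assms(3) by auto
  thus ?thesis
  proof cases
    case exp
    have "0 \<le> 1 / cos d powr ((\<alpha> + \<beta>) / 2)" by simp
    note error[unfolded exp, OF halfline_map_psi_2 this zero_le_one _
        E_psi_2_le_exp_decay[OF _ assms(1,2,6,7)] E_psi_2_le_exp_decay_real[OF assms(6,7)]]
    thus ?thesis unfolding Let_def exp C_const_2_eq by blast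
  next
    case arsinh_exp
    have "0 \<le> c_ad \<alpha> d / cos d powr ((\<alpha> + \<beta>) / 2)" by (simp add: c_ad_nonneg)
    note error[unfolded arsinh_exp, OF halfline_map_psi_3[OF assms(1,2)] this powr_ge_zero _
        E_psi_3_le_exp_decay[OF _ assms(1,2,6,7)] E_psi_3_le_exp_decay_real[OF assms(6,7)]]
    thus ?thesis unfolding Let_def arsinh_exp
      using order_trans[OF _ mult_right_mono[OF C_const_3_ge[OF assms(1,5,6,7)] exp_ge_zero]]
      by blast
  qed
qed

end
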